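(* Let $c>0$ and $\lambda>0$. The law of $W_1(t)=B\left(c^2\mathcal{L}^{1/2}(t)\right)$, $t>0$, coincides with the law of the composition $\mathcal{W}(t)=T(|B(t)|)$, $t>0$, where $T$ is the telegraph process with parameters $c,\lambda$. In other words, for every $t>0$ the following equality in distribution holds: $$B\left(c^2\mathcal{L}^{1/2}(t)\right)\ \stackrel{\mathrm{law}}{=}\ T\left(|B(t)|\right).$$
   Context: $B$ is a one-dimensional Brownian motion normalized so that $\mathbb{E}e^{i\xi B(t)}=e^{-t\xi^2}$ (i.e. variance $2t$), so that $|B(t)|$ has density $p_{|B|}(x,t)=\frac{e^{-x^2/(4t)}}{\sqrt{\pi t}}$, $x>0$, $t>0$. $H^{1/2}(t)$, $t>0$, is the stable subordinator of order $\frac12$ with $\mathbb{E}e^{-\mu H^{1/2}(t)}=e^{-t\sqrt\mu}$, $\mu>0$. Set $\mathcal{H}^{1/2}(t)=t+(2\lambda)^2H^{1/2}(t)$ and let $\mathcal{L}^{1/2}(t)=\inf\{s>0:\mathcal{H}^{1/2}(s)\ge t\}$, $t>0$, be its inverse process. The telegraph process is $T(t)=V(0)\int_0^t(-1)^{N(s)}\,ds$, where $N$ is a homogeneous Poisson process with rate $\lambda$, independent of $V(0)$, which takes the values $\pm c$ with probability $\frac12$ each. Its characteristic function is $$\mathbb{E}e^{i\xi T(t)}=\frac12\left[\left(1+\frac{\lambda}{\sqrt{\lambda^2-c^2\xi^2}}\right)e^{-\lambda t+t\sqrt{\lambda^2-c^2\xi^2}}+\left(1-\frac{\lambda}{\sqrt{\lambda^2-c^2\xi^2}}\right)e^{-\lambda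 t-t\sqrt{\lambda^2-c^2\xi^2}}\right].$$ In each composition the outer process and the random time are independent. *)

theory Defs
  imports "HOL-Probability.Probability"
begin

context prob_space
begin

text \<open>Time runs through \<open>[0, \<infinity>)\<close>; the values of a process at negative times
  are irrelevant.\<close>

definition independent_increments :: "(real \<Rightarrow> 'a \<Rightarrow> 'b::{topological_space, minus}) \<Rightarrow> bool" where
  "independent_increments X \<longleftrightarrow>
     (\<forall>n \<tau>. 0 \<le> \<tau> 0 \<and> incseq \<tau> \<longrightarrow>
        indep_vars (\<lambda>_. borel) (\<lambda>i \<omega>. X (\<tau> (Suc i)) \<omega> - X (\<tau> i) \<omega>) {..<n})"

definition indep_processes ::
  "(real \<Rightarrow> 'a \<Rightarrow> 'b::topological_space) \<Rightarrow> (real \<Rightarrow> 'a \<Rightarrow> 'b) \<Rightarrow> bool" where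
  "indep_processes X Y \<longleftrightarrow>
     indep_var (\<Pi>\<^sub>M t\<in>{0..}. borel) (\<lambda>\<omega>. \<lambda>t\<in>{0..}. X t \<omega>)
               (\<Pi>\<^sub>M t\<in>{0..}. borel) (\<lambda>\<omega>. \<lambda>t\<in>{0..}. Y t \<omega>)"

end

text \<open>Path properties are required of every sample path rather than almost every one, so that
  the processes evaluated at random times below are measurable without completing \<open>M\<close>.\<close>

text \<open>The variance of \<open>B t\<close> is \<open>2 * t\<close>, i.e. its characteristic function is
  \<open>exp (- t * \<xi>\<^sup>2)\<close>. The third argument of \<^const>\<open>normal_density\<close> being the point of
  evaluation, \<open>sqrt (2 * (t - s))\<close> is the standard deviation.\<close>

locale brownian_motion = prob_space M for M :: "'a measure" +
  fixes B :: "real \<Rightarrow> 'a \<Rightarrow> real"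
  assumes measurable_B: "t \<ge> 0 \<Longrightarrow> B t \<in> borel_measurable M"
    and B_0: "\<omega> \<in> space M \<Longrightarrow> B 0 \<omega> = 0"
    and B_increments: "independent_increments B"
    and B_normal: "0 \<le> s \<Longrightarrow> s < t \<Longrightarrow>
      distributed M lborel (\<lambda>\<omega>. B t \<omega> - B s \<omega>) (normal_density 0 (sqrt (2 * (t - s))))"
    and B_continuous: "\<omega> \<in> space M \<Longrightarrow> continuous_on {0..} (\<lambda>t. B t \<omega>)"

locale half_stable_subordinator = prob_space M for M :: "'a measure" +
  fixes H :: "real \<Rightarrow> 'a \<Rightarrow> real"
  assumes measurable_H: "t \<ge> 0 \<Longrightarrow> H t \<in> borel_measurable M"
    and H_0: "\<omega> \<in> space M \<Longrightarrow> H 0 \<omega> = 0"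
    and H_increments: "independent_increments H"
    and H_laplace: "0 \<le> s \<Longrightarrow> s < t \<Longrightarrow> \<mu> > 0 \<Longrightarrow>
      expectation (\<lambda>\<omega>. exp (- \<mu> * (H t \<omega> - H s \<omega>))) = exp (- (t - s) * sqrt \<mu>)"
    and H_mono: "\<omega> \<in> space M \<Longrightarrow> mono_on {0..} (\<lambda>t. H t \<omega>)"
    and H_right_continuous: "\<omega> \<in> space M \<Longrightarrow> t \<ge> 0 \<Longrightarrow> continuous (at_right t) (\<lambda>t. H t \<omega>)"

text \<open>The difference of natural numbers in the increments of \<open>N\<close> is not truncated,
  since the paths are nondecreasing.\<close>

locale poisson_process = prob_space M for M :: "'a measure" +
  fixes rate :: real and N :: "real \<Rightarrow> 'a \<Rightarrow> nat"
  assumes rate_pos: "rate > 0"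
    and measurable_N: "t \<ge> 0 \<Longrightarrow> N t \<in> borel_measurable M"
    and N_0: "\<omega> \<in> space M \<Longrightarrow> N 0 \<omega> = 0"
    and N_increments: "independent_increments N"
    and N_poisson: "0 \<le> s \<Longrightarrow> s < t \<Longrightarrow>
      distr M (count_space UNIV) (\<lambda>\<omega>. N t \<omega> - N s \<omega>) = measure_pmf (poisson_pmf (rate * (t - s)))"
    and N_mono: "\<omega> \<in> space M \<Longrightarrow> mono_on {0..} (\<lambda>t. N t \<omega>)"
    and N_right_continuous: "\<omega> \<in> space M \<Longrightarrow> t \<ge> 0 \<Longrightarrow> continuous (at_right t) (\<lambda>t. N t \<omega>)"

text \<open>The sources of randomness of a telegraph process: a Poisson process of rate \<open>lam\<close> and an
  independent initial velocity \<open>V\<close> with values \<open>c\<close> and \<open>-c\<close>. Independence of \<open>N\<close> and \<open>V\<close>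
  is stated for the generated sigma-algebras, since \<^const>\<open>prob_space.indep_var\<close> relates
  random variables of the same type only.\<close>

locale telegraph_data = poisson_process M lam N
  for M :: "'a measure" and lam :: real and N :: "real \<Rightarrow> 'a \<Rightarrow> nat" +
  fixes c :: real and V :: "'a \<Rightarrow> real"
  assumes c_pos: "c > 0"
    and measurable_V: "V \<in> borel_measurable M"
    and V_plus: "prob {\<omega> \<in> space M. V \<omega> = c} = 1 / 2"
    and V_minus: "prob {\<omega> \<in> space M. V \<omega> = - c} = 1 / 2"
    and N_indep_V: "indep_set
      (sets (vimage_algebra (space M) (\<lambda>\<omega>. \<lambda>t\<in>{0..}. N t \<omega>) (\<Pi>\<^sub>M t\<in>{0..}. borel)))
      (sets (vimage_algebra (space M) V borel))"

definition telegraph :: "('a \<Rightarrow> real) \<Rightarrow> (real \<Rightarrow> 'a \<Rightarrow> nat) \<Rightarrow> real \<Rightarrow> 'a \<Rightarrow> real" where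
  "telegraph V N t \<omega> = V \<omega> * (LBINT s:{0..t}. (- 1) ^ N s \<omega>)"

text \<open>\<open>drifted_subordinator lam H\<close> is the process \<open>t + (2 lam)\<^sup>2 H(t)\<close>.
  All sets below are nonempty and bounded below when \<open>X s \<omega> \<ge> s\<close> for all \<open>s > 0\<close>,
  which holds for \<open>X = drifted_subordinator lam H\<close>.\<close>

definition drifted_subordinator :: "real \<Rightarrow> (real \<Rightarrow> 'a \<Rightarrow> real) \<Rightarrow> real \<Rightarrow> 'a \<Rightarrow> real" where
  "drifted_subordinator lam H t \<omega> = t + (2 * lam)\<^sup>2 * H t \<omega>"

definition inverse_process :: "(real \<Rightarrow> 'a \<Rightarrow> real) \<Rightarrow> real \<Rightarrow> 'a \<Rightarrow> real" where
  "inverse_process X t \<omega> = Inf {s. s > 0 \<and> X s \<omega> \<ge> t}"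

end

theory Submission
  imports Defs "HOL-Real_Asymp.Real_Asymp"
begin

text \<open>
  Conditioning on the independent random times, the characteristic functions at \<open>\<xi>\<close> of the two
  compositions are \<open>E exp (- \<theta> L(t))\<close> and \<open>E C(|B(t)|)\<close>, where \<open>\<theta> = c\<^sup>2 \<xi>\<^sup>2\<close> and \<open>C\<close> is the
  characteristic function of the telegraph process. Both are bounded and continuous in \<open>t > 0\<close>, so it
  suffices to compare their Laplace transforms at \<open>\<mu> = \<nu>\<^sup>2\<close>. For the first one,
  \<open>s < L(t)\<close> means \<open>s + (2 \<lambda>)\<^sup>2 H(s) < t\<close>, so integrating out \<open>t\<close> before \<open>s\<close> leaves only the Laplace
  transform of \<open>H(s)\<close>. For the second one, the Laplace transform in \<open>t\<close> of the Gaussian density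
  is \<open>exp (- \<nu> |x|) / (2 \<nu>)\<close>, which leaves the Laplace transform of \<open>C\<close> at \<open>\<nu>\<close>; it comes from the linear
  differential equations that follow from the independence of the increments of the Poisson
  process. Both transforms equal \<open>(\<nu> + 2 \<lambda>) / (\<nu> (\<nu> (\<nu> + 2 \<lambda>) + \<theta>))\<close>.
\<close>

subsection \<open>Laplace transforms\<close>

text \<open>The identity rests on one match of constants. The sign (-1)^N decorrelates at rate
  \<open>2 * lam\<close>, because the Poisson generating function at -1 is exp(-2r). The factor (2
  lam)^2 in front of \<open>H\<close> produces the same \<open>2 * lam\<close>, since sqrt((2 lam)^2
  mu) = 2 lam nu when mu = nu^2. This substitution removes every square root: both transforms become
  rational in nu, so they are compared by algebra alone, whatever the sign of lam^2 - c^2 xi^2. The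
  obstacle is that independence is given for finitely many increments, or for path sigma-algebras
  over an uncountable index set, whereas the compositions and the time integral of the sign depend
  on whole paths. Grids whose cells are represented by their right end points therefore recur:
  right-continuity of the paths is exactly what makes them converge, for measurability at random
  times, for conditioning on an independent time and for Riemann sums alike.\<close>

text \<open>Under y = exp(-t) the transform at 1, 2, 3, ... becomes the moment sequence of a finite
  signed measure on [0, 1]; by Stone-Weierstrass, vanishing moments make it orthogonal to every
  continuous function.\<close>

lemma laplace_transform_eq_0_imp_eq_0:
  fixes f :: "real \<Rightarrow> real"
  assumes cont: "continuous_on {0<..} f" and bdd: "\<And>t. 0 < t \<Longrightarrow> \<bar>f t\<bar> \<le> K"
    and lap: "\<And>\<mu>. 0 < \<mu> \<Longrightarrow> (LBINT t:{0<..}. exp (- (\<mu> * t)) * f t) = 0"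
    and "0 < t"
  shows "f t = 0"
proof -
  define f0 where "f0 t = indicator {0<..} t * f t" for t
  have K: "0 \<le> K" using bdd[of 1] by simp
  have f0_bdd: "\<bar>f0 t\<bar> \<le> K" for t
    using bdd[of t] K by (auto simp: f0_def split: split_indicator)
  have f0_meas [measurable]: "f0 \<in> borel_measurable borel"
    unfolding f0_def using borel_measurable_continuous_on_indicator[OF _ cont] by simp
  \<comment> \<open>One factor exp(-t) stays in the weight to make it integrable; the i-th moment is
    then the transform at 1 + i.\<close>
  define w where "w t = exp (- t) * f0 t" for t
  have w_meas [measurable]: "w \<in> borel_measurable borel" unfolding w_def by measurable
  have exp_int: "integrable lborel (\<lambda>t. K * (indicator {0<..} t * exp (- t)))"
    using integrable_I0i_exp_mscale[of 1] by (intro integrable_mult_right) (simp add: set_integrable_def)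
  have w_bdd: "\<bar>w t\<bar> \<le> K * (indicator {0<..} t * exp (- t))" for t
    using f0_bdd[of t] by (auto simp: w_def f0_def abs_mult split: split_indicator)
  have w_int: "integrable lborel w"
    by (rule Bochner_Integration.integrable_bound[OF exp_int]) (use w_bdd K in \<open>auto simp: abs_mult\<close>)
  have wg: "(LBINT t. w t * g (exp (- t))) = 0"
    if g: "continuous_on {0..1} g" and gm [measurable]: "g \<in> borel_measurable borel"
      and g_bdd: "\<And>y. \<bar>g y\<bar> \<le> K'" for g and K' :: real
  proof -
    define C where "C = (LBINT t. \<bar>w t\<bar>)"
    have C: "0 \<le> C" unfolding C_def by simp
    have K': "0 \<le> K'" using g_bdd[of 0] by simp
    have int_g: "integrable lborel (\<lambda>t. w t * g (exp (- t)))"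
    proof (rule Bochner_Integration.integrable_bound)
      show "integrable lborel (\<lambda>t. K' * w t)" using w_int by simp
      show "AE t in lborel. norm (w t * g (exp (- t))) \<le> norm (K' * w t)"
        using g_bdd K' by (intro AE_I2) (auto simp: abs_mult mult.commute[of K'] intro!: mult_left_mono)
    qed measurable
    have "\<bar>LBINT t. w t * g (exp (- t))\<bar> \<le> 0 + e" if e: "0 < e" for e
    proof -
      \<comment> \<open>The tolerance is divided by \<open>C + 1\<close> because \<open>C\<close>
        may be 0.\<close>
      obtain p where p: "real_polynomial_function p"
        and pg: "\<And>y. y \<in> {0..1} \<Longrightarrow> \<bar>g y - p y\<bar> < e / (C + 1)"
        using Stone_Weierstrass_real_polynomial_function[OF compact_Icc g, of "e / (C + 1)"] e C
        by auto
      obtain a n where p_eq: "p = (\<lambda>x. \<Sum>i\<le>n. a i * x ^ i)"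
        using p unfolding real_polynomial_function_iff_sum by auto
      have wi: "integrable lborel (\<lambda>t. w t * (a i * exp (- t) ^ i))" for i
      proof (rule Bochner_Integration.integrable_bound)
        show "integrable lborel (\<lambda>t. a i * w t)" using w_int by simp
        have "norm (w t * (a i * exp (- t) ^ i)) \<le> norm (a i * w t)" for t
        proof (cases "0 < t")
          case True
          then have "exp (- t) ^ i \<le> 1" by (intro power_le_one) auto
          then show ?thesis
            by (auto simp: abs_mult mult.assoc[symmetric] mult.commute[of "\<bar>w t\<bar>"] intro!: mult_left_le)
        qed (simp add: w_def f0_def)
        then show "AE t in lborel. norm (w t * (a i * exp (- t) ^ i)) \<le> norm (a i * w t)" by simp
      qed measurable
      have int_p: "integrable lborel (\<lambda>t. w t * p (exp (- t)))"
        unfolding p_eq sum_distrib_left by (intro Bochner_Integration.integrable_sum wi)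
      have "(LBINT t. w t * (a i * exp (- t) ^ i)) = 0" for i
      proof -
        have "(LBINT t. w t * (a i * exp (- t) ^ i))
            = (LBINT t. a i * (indicator {0<..} t * (exp (- ((1 + real i) * t)) * f t)))"
        proof (intro Bochner_Integration.integral_cong)
          fix t :: real
          have "exp (- t) * exp (- t) ^ i = exp (- ((1 + real i) * t))"
            by (simp add: exp_of_nat_mult[symmetric] exp_add[symmetric] algebra_simps)
          moreover have "w t * (a i * exp (- t) ^ i)
              = a i * (indicator {0<..} t * ((exp (- t) * exp (- t) ^ i) * f t))"
            by (simp add: w_def f0_def ac_simps)
          ultimately show "w t * (a i * exp (- t) ^ i)
              = a i * (indicator {0<..} t * (exp (- ((1 + real i) * t)) * f t))"
            by (simp only:)
        qed simp
        also have "\<dots> = a i * (LBINT t:{0<..}. exp (- ((1 + real i) * t)) * f t)"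
          by (simp add: set_lebesgue_integral_def)
        also have "\<dots> = 0" by (subst lap) auto
        finally show ?thesis .
      qed
      then have p0: "(LBINT t. w t * p (exp (- t))) = 0"
        unfolding p_eq sum_distrib_left by (subst Bochner_Integration.integral_sum) (auto intro: wi)
      have "\<bar>LBINT t. w t * g (exp (- t))\<bar> = \<bar>LBINT t. w t * g (exp (- t)) - w t * p (exp (- t))\<bar>"
        by (subst Bochner_Integration.integral_diff[OF int_g int_p]) (simp add: p0)
      also have "\<dots> \<le> (LBINT t. \<bar>w t * g (exp (- t)) - w t * p (exp (- t))\<bar>)"
        by (rule integral_abs_bound)
      also have "\<dots> \<le> (LBINT t. \<bar>w t\<bar> * (e / (C + 1)))"
      proof (rule integral_mono)
        fix t
        show "\<bar>w t * g (exp (- t)) - w t * p (exp (- t))\<bar> \<le> \<bar>w t\<bar> * (e / (C + 1))"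
        proof (cases "0 < t")
          case True
          then have "\<bar>w t\<bar> * \<bar>g (exp (- t)) - p (exp (- t))\<bar> \<le> \<bar>w t\<bar> * (e / (C + 1))"
            using pg[of "exp (- t)"] by (intro mult_left_mono) auto
          then show ?thesis by (simp only: right_diff_distrib[symmetric] abs_mult)
        qed (simp add: w_def f0_def)
      qed (use w_int int_g int_p in auto)
      also have "\<dots> = C / (C + 1) * e" by (simp add: C_def)
      also have "\<dots> \<le> 1 * e" using C e by (intro mult_right_mono) auto
      finally show ?thesis by simp
    qed
    then have "\<bar>LBINT t. w t * g (exp (- t))\<bar> \<le> 0" by (rule field_le_epsilon)
    then show ?thesis by simp
  qed
  \<comment> \<open>testing against \<open>g\<close> amounts to integrating \<open>(f t)\<^sup>2\<close> against a positive weight; the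
    factor \<open>y * (1 - y)\<close> makes \<open>g\<close> continuous at the end points\<close>
  define g where "g y = (if 0 < y \<and> y < 1 then y * (1 - y) * f0 (- ln y) else 0)" for y
  have g_le: "\<bar>g y\<bar> \<le> \<bar>K * (y * (1 - y))\<bar>" for y
    using f0_bdd[of "- ln y"] K by (auto simp: g_def abs_mult mult.commute[of K] intro!: mult_left_mono)
  have g_lim: "(g \<longlongrightarrow> 0) (at y within {0..1})" if "y * (1 - y) = 0" for y
  proof (rule Lim_null_comparison)
    show "\<forall>\<^sub>F x in at y within {0..1}. norm (g x) \<le> \<bar>K * (x * (1 - x))\<bar>"
      using g_le by simp
    have "((\<lambda>x. \<bar>K * (x * (1 - x))\<bar>) \<longlongrightarrow> \<bar>K * (y * (1 - y))\<bar>) (at y within {0..1})"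
      by (intro tendsto_intros)
    then show "((\<lambda>x. \<bar>K * (x * (1 - x))\<bar>) \<longlongrightarrow> 0) (at y within {0..1})"
      using that by simp
  qed
  have g_cont: "continuous_on {0..1} g"
    unfolding continuous_on_eq_continuous_within
  proof
    fix y :: real assume y: "y \<in> {0..1}"
    show "continuous (at y within {0..1}) g"
    proof (cases "0 < y \<and> y < 1")
      case True
      have "continuous_on {0<..<1} (\<lambda>y. y * (1 - y) * f (- ln y))"
        by (intro continuous_intros continuous_on_compose2[OF cont]) auto
      then have "continuous_on {0<..<1} g"
        by (rule continuous_on_eq) (auto simp: g_def f0_def)
      then have "isCont g y"
        using True by (simp add: continuous_on_eq_continuous_at)
      then show ?thesis by (rule continuous_at_imp_continuous_at_within)
    next
      case False
      then have "y * (1 - y) = 0" using y by auto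
      moreover have "g y = 0" using False by (auto simp: g_def)
      ultimately show ?thesis using g_lim by (simp add: continuous_within)
    qed
  qed
  have g_meas: "g \<in> borel_measurable borel" unfolding g_def by measurable
  have "\<bar>g y\<bar> \<le> K" for y
    using f0_bdd[of "- ln y"] K
    by (auto simp: g_def abs_mult intro!: mult_le_one mult_left_le_one_le[THEN order_trans])
  from wg[OF g_cont g_meas this] have zero: "(LBINT t. w t * g (exp (- t))) = 0" .
  define h where "h t = exp (- t) * (exp (- t) * (1 - exp (- t))) * (f t)\<^sup>2" for t
  have wh: "w t * g (exp (- t)) = indicator {0<..} t * h t" for t
    by (auto simp: w_def g_def f0_def h_def power2_eq_square)
  have h_nn: "0 \<le> h t" if "0 < t" for t using that unfolding h_def by simp
  have h_cont: "continuous_on {t/2..t} h"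
    unfolding h_def using \<open>0 < t\<close> by (intro continuous_intros continuous_on_subset[OF cont]) auto
  have h_int: "integrable lborel (\<lambda>t. indicator {0<..} t * h t)"
  proof (rule Bochner_Integration.integrable_bound)
    show "integrable lborel (\<lambda>t. K * w t)" using w_int by simp
    show "(\<lambda>t. indicator {0<..} t * h t) \<in> borel_measurable lborel"
      unfolding wh[symmetric] using g_meas by measurable
    show "AE t in lborel. norm (indicator {0<..} t * h t) \<le> norm (K * w t)"
      unfolding wh[symmetric] using \<open>\<And>y. \<bar>g y\<bar> \<le> K\<close> K
      by (intro AE_I2) (auto simp: abs_mult mult.commute[of K] intro!: mult_left_mono)
  qed
  have "AE t in lborel. indicator {0<..} t * h t = 0"
    using zero h_int unfolding wh
    by (subst (asm) integral_nonneg_eq_0_iff_AE) (auto simp: h_nn split: split_indicator)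
  \<comment> \<open>Orthogonality gives \<open>h = 0\<close> only almost everywhere. On
    \<open>{t/2..t}\<close>, which stays away from 0, \<open>h\<close> is continuous and
    nonnegative, so a zero integral forces it to vanish at \<open>t\<close> itself.\<close>
  then have "(LBINT s:{t/2..t}. h s) = 0"
    unfolding set_lebesgue_integral_def using \<open>0 < t\<close>
    by (intro integral_eq_zero_AE) (auto elim!: eventually_mono split: split_indicator_asm)
  then have "integral {t/2..t} h = 0"
    using set_borel_integral_eq_integral(2)[OF borel_integrable_atLeastAtMost'[OF h_cont]] by simp
  then have "h t = 0"
    using \<open>0 < t\<close> h_nn by (subst (asm) integral_eq_0_iff[OF h_cont]) auto
  then show ?thesis using \<open>0 < t\<close> by (simp add: h_def)
qed

lemma exp_times_bounded_set_integrable: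
  fixes h :: "real \<Rightarrow> real"
  assumes "0 < m" "continuous_on {0<..} h" and h: "\<And>x. \<bar>h x\<bar> \<le> 1"
  shows "set_integrable lborel {0<..} (\<lambda>x. exp (- (m * x)) * h x)"
  unfolding set_integrable_def
proof (rule Bochner_Integration.integrable_bound)
  show "integrable lborel (\<lambda>x. indicat_real {0<..} x *\<^sub>R exp (- (x * m)))"
    using integrable_I0i_exp_mscale[OF assms(1)] by (simp add: set_integrable_def)
  have "(\<lambda>x. indicator {0<..} x *\<^sub>R (exp (- (m * x)) * h x)) \<in> borel_measurable borel"
    by (intro borel_measurable_continuous_on_indicator continuous_intros assms(2)) auto
  then show "(\<lambda>x. indicator {0<..} x *\<^sub>R (exp (- (m * x)) * h x)) \<in> borel_measurable lborel"
    by simp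
  show "AE x in lborel. norm (indicat_real {0<..} x *\<^sub>R (exp (- (m * x)) * h x))
      \<le> norm (indicat_real {0<..} x *\<^sub>R exp (- (x * m)))"
    using h by (intro AE_I2) (auto simp: abs_mult mult.commute[of m] mult_left_le split: split_indicator)
qed

text \<open>The transforms are compared at squares because both explicit formulas are rational in
  \<nu>; every positive parameter is the square of its root.\<close>

lemma laplace_transform_unique:
  fixes f g :: "real \<Rightarrow> real"
  assumes cont: "continuous_on {0<..} f" "continuous_on {0<..} g"
    and bdd: "\<And>t. \<bar>f t\<bar> \<le> 1" "\<And>t. \<bar>g t\<bar> \<le> 1"
    and lap: "\<And>\<nu>. 0 < \<nu> \<Longrightarrow> (LBINT t:{0<..}. exp (- (\<nu>\<^sup>2 * t)) * f t) = (LBINT t:{0<..}. exp (- (\<nu>\<^sup>2 * t)) * g t)"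
    and "0 < t"
  shows "f t = g t"
proof -
  have "(\<lambda>t. f t - g t) t = 0"
  proof (rule laplace_transform_eq_0_imp_eq_0[OF _ _ _ \<open>0 < t\<close>])
    show "continuous_on {0<..} (\<lambda>t. f t - g t)" by (intro continuous_intros cont)
    show "\<bar>f t - g t\<bar> \<le> 2" for t using bdd[of t] by linarith
    fix \<mu> :: real assume "0 < \<mu>"
    then have "(LBINT t:{0<..}. exp (- (\<mu> * t)) * f t) = (LBINT t:{0<..}. exp (- (\<mu> * t)) * g t)"
      using lap[of "sqrt \<mu>"] by simp
    moreover have "set_integrable lborel {0<..} (\<lambda>t. exp (- (\<mu> * t)) * f t)"
      "set_integrable lborel {0<..} (\<lambda>t. exp (- (\<mu> * t)) * g t)"
      using \<open>0 < \<mu>\<close> cont bdd by (auto intro!: exp_times_bounded_set_integrable)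
    ultimately show "(LBINT t:{0<..}. exp (- (\<mu> * t)) * (f t - g t)) = 0"
      by (simp add: right_diff_distrib set_integral_diff)
  qed
  then show ?thesis by simp
qed

section \<open>Exponential integrals and the Laplace transform of the heat kernel\<close>

text \<open>Read from right to left, with \<open>l\<close> the inverse process at time
  \<open>t\<close>: that process then enters only through the range of integration. The interval is
  half-open to fit the strict inequality in \<open>less_inverse_process_iff\<close>.\<close>

lemma nn_integral_exp_atLeastLessThan:
  fixes \<theta> l :: real
  assumes "0 \<le> \<theta>" "0 \<le> l"
  shows "(\<integral>\<^sup>+s. ennreal (\<theta> * exp (- (\<theta> * s))) * indicator {0..<l} s \<partial>lborel) = ennreal (1 - exp (- (\<theta> * l)))"
proof -
  have "(\<integral>\<^sup>+s. ennreal (\<theta> * exp (- (\<theta> * s))) * indicator {0..<l} s \<partial>lborel)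
      = (\<integral>\<^sup>+s. ennreal (\<theta> * exp (- (\<theta> * s))) * indicator {0..l} s \<partial>lborel)"
    by (rule nn_integral_cong_AE)
      (use AE_lborel_singleton[of l] in \<open>auto elim!: eventually_mono split: split_indicator\<close>)
  also have "\<dots> = ennreal (- exp (- (\<theta> * l)) - - exp (- (\<theta> * 0)))"
    using assms by (intro nn_integral_FTC_Icc) (auto intro!: derivative_eq_intros simp: has_real_derivative_iff_has_vector_derivative[symmetric])
  finally show ?thesis by simp
qed

text \<open>The two constants are kept apart because both cases \<open>\<mu> = q\<close> (integral
  over time) and \<open>\<mu> \<noteq> q\<close> (final integral over the subordinator's time)
  occur.\<close>

lemma nn_integral_exp_greaterThan:
  fixes \<mu> q l :: real
  assumes "0 \<le> \<mu>" "0 < q"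
  shows "(\<integral>\<^sup>+t. ennreal (\<mu> * exp (- (q * t))) * indicator {l<..} t \<partial>lborel) = ennreal (\<mu> / q * exp (- (q * l)))"
proof -
  have "(\<integral>\<^sup>+t. ennreal (\<mu> * exp (- (q * t))) * indicator {l<..} t \<partial>lborel)
      = (\<integral>\<^sup>+t. ennreal (\<mu> * exp (- (q * t))) * indicator {l..} t \<partial>lborel)"
    by (rule nn_integral_cong_AE)
      (use AE_lborel_singleton[of l] in \<open>auto elim!: eventually_mono split: split_indicator\<close>)
  also have "\<dots> = ennreal (0 - - (\<mu> / q * exp (- (q * l))))"
  proof (rule nn_integral_FTC_atLeast)
    show "((\<lambda>t. - (\<mu> / q * exp (- (q * t)))) \<longlongrightarrow> 0) at_top"
      using assms(2) by real_asymp
  qed (use assms in \<open>auto intro!: derivative_eq_intros\<close>)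
  finally show ?thesis by simp
qed

lemma cdf_std_normal_has_real_derivative:
  "(cdf std_normal_distribution has_real_derivative std_normal_density z) (at z)"
proof -
  interpret real_distribution std_normal_distribution by (rule real_dist_normal_dist)
  \<comment> \<open>Any point to the left of \<open>z\<close> serves; it replaces the lower limit
    minus infinity and makes the interval compact.\<close>
  define m where "m = z - 1"
  have eq: "cdf std_normal_distribution m + integral {m..y} std_normal_density
      = cdf std_normal_distribution y" if "m < y" for y
  proof -
    have "cdf std_normal_distribution y - cdf std_normal_distribution m
        = measure std_normal_distribution {m<..y}"
      using that by (rule cdf_diff_eq)
    also have "\<dots> = (LINT x:{m<..y}|lborel. std_normal_density x)"
      unfolding set_lebesgue_integral_def
      using integral_density[of "indicat_real {m<..y}" lborel std_normal_density]
      by (simp add: mult.commute)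
    also have "\<dots> = (LINT x:{m..y}|lborel. std_normal_density x)"
    proof (rule set_integral_cong_set)
      have "AE x in lborel. x \<noteq> m" by (rule AE_lborel_singleton)
      then show "AE x in lborel. x \<in> {m..y} \<longleftrightarrow> x \<in> {m<..y}" 
        by eventually_elim auto
    qed (auto simp: set_borel_measurable_def)
    also have "\<dots> = integral {m..y} std_normal_density"
      by (intro set_borel_integral_eq_integral)
        (simp add: set_integrable_def integrable_mult_indicator del: real_scaleR_def)
    finally show ?thesis by simp
  qed
  have "((\<lambda>y. integral {m..y} std_normal_density) has_real_derivative std_normal_density z)
      (at z within {m..z + 1})"
    by (rule integral_has_real_derivative)
      (auto simp: m_def normal_density_def intro!: continuous_intros)
  then have "((\<lambda>y. integral {m..y} std_normal_density) has_real_derivative std_normal_density z) (at z)"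
    by (subst (asm) at_within_interior) (auto simp: m_def)
  then have "((\<lambda>y. cdf std_normal_distribution m + integral {m..y} std_normal_density)
      has_real_derivative std_normal_density z) (at z)"
    by (auto intro!: derivative_eq_intros)
  moreover have "eventually (\<lambda>y. m < y) (nhds z)"
    using eventually_nhds_in_open[of "{m<..}" z] by (simp add: m_def)
  ultimately show ?thesis
    by (subst (asm) DERIV_cong_ev[OF refl _ refl]) (auto elim!: eventually_mono simp: eq)
qed

text \<open>The right-hand side is the Green function of \<nu>^2 - d^2/dx^2 on the line.\<close>

lemma heat_kernel_laplace:
  fixes x \<nu> :: real
  assumes x: "0 < x" and \<nu>: "0 < \<nu>"
  shows "(LBINT t:{0<..}. exp (- (\<nu>\<^sup>2 * t)) * normal_density 0 (sqrt (2 * t)) x)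
    = exp (- (\<nu> * x)) / (2 * \<nu>)"
proof -
  define f where "f t = exp (- (\<nu>\<^sup>2 * t)) * normal_density 0 (sqrt (2 * t)) x" for t
  interpret real_distribution std_normal_distribution by (rule real_dist_normal_dist)
  define \<Phi> where "\<Phi> = cdf std_normal_distribution"
  define p where "p t = sqrt 2 * (\<nu> * sqrt t + x / (2 * sqrt t))" for t
  define q where "q t = sqrt 2 * (\<nu> * sqrt t - x / (2 * sqrt t))" for t
  \<comment> \<open>the classical antiderivative in terms of the error function, written with the normal
    distribution function\<close>
  define F where "F t = (exp (\<nu> * x) * \<Phi> (p t) + exp (- (\<nu> * x)) * \<Phi> (q t)) / (2 * \<nu>)" for t
  have F': "DERIV F t :> f t" if "0 < t" for t
  proof -
    note d = DERIV_chain2[OF cdf_std_normal_has_real_derivative, folded \<Phi>_def]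
    have dp: "(p has_real_derivative sqrt 2 * (\<nu> / (2 * sqrt t) - x / (4 * (t * sqrt t)))) (at t)"
      unfolding p_def using that
      by (auto intro!: derivative_eq_intros simp: field_simps power2_eq_square)
    have dq: "(q has_real_derivative sqrt 2 * (\<nu> / (2 * sqrt t) + x / (4 * (t * sqrt t)))) (at t)"
      unfolding q_def using that
      by (auto intro!: derivative_eq_intros simp: field_simps power2_eq_square)
    have p2: "(p t)\<^sup>2 / 2 = \<nu>\<^sup>2 * t + \<nu> * x + x\<^sup>2 / (4 * t)"
      unfolding p_def using that by (simp add: power_mult_distrib power2_sum power_divide field_simps)
    have q2: "(q t)\<^sup>2 / 2 = \<nu>\<^sup>2 * t - \<nu> * x + x\<^sup>2 / (4 * t)"
      unfolding q_def using that by (simp add: power_mult_distrib power2_diff power_divide field_simps)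
    \<comment> \<open>By \<open>p2\<close> and \<open>q2\<close> the two squares differ only in the
      sign of \<open>\<nu> * x\<close>, which the exponential factors of \<open>F\<close>
      compensate. Both summands of the derivative thus carry the same Gaussian \<open>E\<close>, and
      the terms with \<open>x\<close> in \<open>dp\<close> and \<open>dq\<close> cancel.\<close>
    define E where "E = exp (- (\<nu>\<^sup>2 * t)) * exp (- x\<^sup>2 / (4 * t)) / sqrt (2 * pi)"
    have Ep: "exp (\<nu> * x) * std_normal_density (p t) = E"
    proof -
      have "\<nu> * x + - (p t)\<^sup>2 / 2 = - (\<nu>\<^sup>2 * t) + - x\<^sup>2 / (4 * t)"
        unfolding minus_divide_left[symmetric] p2 by simp
      then show ?thesis
        unfolding std_normal_density_def E_def by (simp add: exp_add[symmetric])
    qed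
    have Eq: "exp (- (\<nu> * x)) * std_normal_density (q t) = E"
    proof -
      have "- (\<nu> * x) + - (q t)\<^sup>2 / 2 = - (\<nu>\<^sup>2 * t) + - x\<^sup>2 / (4 * t)"
        unfolding minus_divide_left[symmetric] q2 by simp
      then show ?thesis
        unfolding std_normal_density_def E_def by (simp add: exp_add[symmetric])
    qed
    have "DERIV F t :> (exp (\<nu> * x) * (std_normal_density (p t) * (sqrt 2 * (\<nu> / (2 * sqrt t) - x / (4 * (t * sqrt t)))))
        + exp (- (\<nu> * x)) * (std_normal_density (q t) * (sqrt 2 * (\<nu> / (2 * sqrt t) + x / (4 * (t * sqrt t)))))) / (2 * \<nu>)"
      unfolding F_def by (intro DERIV_cdivide DERIV_add DERIV_cmult d dp dq)
    also have "(exp (\<nu> * x) * (std_normal_density (p t) * (sqrt 2 * (\<nu> / (2 * sqrt t) - x / (4 * (t * sqrt t)))))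
        + exp (- (\<nu> * x)) * (std_normal_density (q t) * (sqrt 2 * (\<nu> / (2 * sqrt t) + x / (4 * (t * sqrt t)))))) / (2 * \<nu>)
       = (E * (sqrt 2 * (\<nu> / (2 * sqrt t) - x / (4 * (t * sqrt t))))
        + E * (sqrt 2 * (\<nu> / (2 * sqrt t) + x / (4 * (t * sqrt t))))) / (2 * \<nu>)"
      unfolding mult.assoc[symmetric] Ep Eq ..
    also have "\<dots> = E * sqrt 2 / (2 * sqrt t)"
      using \<nu> that by (simp add: field_simps)
    also have "\<dots> = f t"
      unfolding f_def E_def normal_density_def using that
      by (simp add: real_sqrt_mult field_simps)
    finally show ?thesis .
  qed
  have \<Phi>_top: "(\<Phi> \<longlongrightarrow> 1) at_top" and \<Phi>_bot: "(\<Phi> \<longlongrightarrow> 0) at_bot"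
    unfolding \<Phi>_def by (rule cdf_lim_at_top_prob cdf_lim_at_bot)+
  have p0: "filterlim p at_top (at_right 0)" and q0: "filterlim q at_bot (at_right 0)"
    and p1: "filterlim p at_top at_top" and q1: "filterlim q at_top at_top"
    unfolding p_def q_def using x \<nu> by real_asymp+
  \<comment> \<open>Since \<open>x > 0\<close>, \<open>q\<close> tends to minus infinity at 0 but to
    plus infinity at infinity, while \<open>p\<close> tends to plus infinity at both ends. Only the
    summand with \<open>exp (- (\<nu> * x))\<close> survives in the difference of the
    limits.\<close>
  have A: "((F \<circ> real_of_ereal) \<longlongrightarrow> (exp (\<nu> * x) * 1 + exp (- (\<nu> * x)) * 0) / (2 * \<nu>)) (at_right 0)"
    unfolding zero_ereal_def ereal_tendsto_simps1(2) F_def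
    using \<nu> by (intro tendsto_intros filterlim_compose[OF \<Phi>_top p0] filterlim_compose[OF \<Phi>_bot q0]) auto
  have B: "((F \<circ> real_of_ereal) \<longlongrightarrow> (exp (\<nu> * x) * 1 + exp (- (\<nu> * x)) * 1) / (2 * \<nu>)) (at_left \<infinity>)"
    unfolding ereal_tendsto_simps1 F_def
    using \<nu> by (intro tendsto_intros filterlim_compose[OF \<Phi>_top p1] filterlim_compose[OF \<Phi>_top q1]) auto
  have ei: "einterval 0 \<infinity> = {0<..}"
    by (auto simp: einterval_def)
  have cont: "isCont f t" if "0 < t" for t
    unfolding f_def normal_density_def using that by (intro continuous_intros) auto
  have nn: "0 \<le> f t" for t unfolding f_def by simp
  note FTC = interval_integral_FTC_nonneg[OF _ _ _ _ A B, of f]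
  have "(LBINT t=0..\<infinity>. f t) = exp (- (\<nu> * x)) / (2 * \<nu>)"
    using FTC(2) F' cont nn by (simp add: diff_divide_distrib[symmetric])
  then show ?thesis
    by (simp add: interval_lebesgue_integral_def ei f_def)
qed

subsection \<open>Processes evaluated at random times\<close>

text \<open>Exactly one cell contains \<open>r\<close>, so the sum reduces to \<open>u\<close> at
  the right end point of that cell. This point lies strictly above \<open>r\<close> and tends to
  \<open>r\<close>, so right-continuity suffices.\<close>

lemma step_approximation_tendsto:
  fixes u :: "real \<Rightarrow> 'b::real_normed_vector" and d :: "nat \<Rightarrow> real" and K :: "nat \<Rightarrow> nat"
  assumes "0 \<le> r" and u: "continuous (at_right r) u"
    and d: "\<And>n. 0 < d n" "d \<longlonglongrightarrow> 0" and K: "\<forall>\<^sub>F n in sequentially. r < real (K n) * d n"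
  shows "(\<lambda>n. \<Sum>k<K n. indicator {real k * d n..<(real k + 1) * d n} r *\<^sub>R u ((real k + 1) * d n))
    \<longlonglongrightarrow> u r"
proof -
  define k where "k n = nat \<lfloor>r / d n\<rfloor>" for n
  define q where "q n = (real (k n) + 1) * d n" for n
  have k: "real (k n) \<le> r / d n" "r / d n < real (k n) + 1" for n
    using \<open>0 \<le> r\<close> d(1)[of n] by (auto simp: k_def)
  have k': "real (k n) * d n \<le> r" "r < q n" for n
    using k[of n] d(1)[of n] by (auto simp: q_def field_simps)
  have "q \<longlonglongrightarrow> r"
  proof (rule tendsto_sandwich[where f="\<lambda>_. r" and h="\<lambda>n. r + d n"])
    show "(\<lambda>n. r + d n) \<longlonglongrightarrow> r" using tendsto_add[OF tendsto_const d(2)] by simp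
    show "\<forall>\<^sub>F n in sequentially. r \<le> q n" using k'(2) by (intro always_eventually allI less_imp_le)
    show "\<forall>\<^sub>F n in sequentially. q n \<le> r + d n"
      using k'(1) by (intro always_eventually allI) (simp add: q_def distrib_right)
  qed auto
  then have "filterlim q (at_right r) sequentially"
    using k'(2) unfolding filterlim_at by (simp add: less_imp_neq[symmetric])
  then have lim: "(\<lambda>n. u (q n)) \<longlonglongrightarrow> u r"
    using u filterlim_compose unfolding continuous_within by blast
  have "\<forall>\<^sub>F n in sequentially. u (q n) =
    (\<Sum>k<K n. indicator {real k * d n..<(real k + 1) * d n} r *\<^sub>R u ((real k + 1) * d n))"
    using K
  proof eventually_elim
    case (elim n)
    have eq: "indicator {real j * d n..<(real j + 1) * d n} r = (if j = k n then 1 else (0::real))" for j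
    proof -
      have "j = k n" if "real j * d n \<le> r" "r < (real j + 1) * d n"
      proof -
        have "real j * d n < (real (k n) + 1) * d n" "real (k n) * d n < (real j + 1) * d n"
          using that k'[of n] unfolding q_def by linarith+
        then have "real j < real (k n) + 1" "real (k n) < real j + 1"
          using d(1)[of n] by simp_all
        then show ?thesis by linarith
      qed
      then have "r \<in> {real j * d n..<(real j + 1) * d n} \<longleftrightarrow> j = k n"
        using k'[of n] unfolding q_def by (metis atLeastLessThan_iff)
      then show ?thesis by (simp add: indicator_def)
    qed
    have "real (k n) * d n < real (K n) * d n" using k'(1)[of n] elim by (rule le_less_trans)
    then have "k n < K n"
      using d(1)[of n] by simp
    have "(\<Sum>j<K n. indicator {real j * d n..<(real j + 1) * d n} r *\<^sub>R u ((real j + 1) * d n))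
        = (\<Sum>j<K n. if j = k n then u (q n) else 0)"
      by (rule sum.cong) (auto simp: eq q_def)
    then show ?case using \<open>k n < K n\<close> by simp
  qed
  with lim show ?thesis by (rule Lim_transform_eventually)
qed

text \<open>The cells are disjoint, so at most one summand is nonzero. This yields bounds
  independent of the mesh for dominated convergence.\<close>

lemma norm_step_le:
  fixes v :: "nat \<Rightarrow> 'b::real_normed_vector"
  assumes "0 < d" and C: "0 \<le> C" "\<And>k. norm (v k) \<le> C"
  shows "norm (\<Sum>k<m. indicator {real k * d..<(real k + 1) * d} r *\<^sub>R v k) \<le> C"
proof -
  let ?I = "\<lambda>k. indicator {real k * d..<(real k + 1) * d} r :: real"
  have "norm (\<Sum>k<m. ?I k *\<^sub>R v k) \<le> (\<Sum>k<m. ?I k * C)"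
    by (rule sum_norm_le) (auto intro!: mult_left_mono C)
  also have "\<dots> = (\<Sum>k<m. ?I k) * C"
    by (rule sum_distrib_right[symmetric])
  also have "(\<Sum>k<m. ?I k) \<le> 1"
  proof -
    have "disjoint_family_on (\<lambda>k. {real k * d..<(real k + 1) * d}) {..<m}"
      unfolding disjoint_family_on_def
    proof (intro ballI impI)
      fix i j :: nat assume "i \<noteq> j"
      then consider "real i + 1 \<le> real j" | "real j + 1 \<le> real i" by linarith
      then have "(real i + 1) * d \<le> real j * d \<or> (real j + 1) * d \<le> real i * d"
        using \<open>0 < d\<close> by cases (auto intro!: mult_right_mono)
      then show "{real i * d..<(real i + 1) * d} \<inter> {real j * d..<(real j + 1) * d} = {}"
        by auto
    qed
    then have "(\<Sum>k<m. ?I k) = indicator (\<Union>k<m. {real k * d..<(real k + 1) * d}) r"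
      by (intro indicator_UN_disjoint[symmetric]) auto
    then show ?thesis by simp
  qed
  finally show ?thesis using C(1) by (simp add: mult_right_mono)
qed

text \<open>Taking (n+1)^2 cells of width 1/(n+1) refines the grid and at the same time exhausts the
  half-line.\<close>

lemma eventually_less_mesh_bound:
  "\<forall>\<^sub>F n in sequentially. r < real (Suc n * Suc n) * inverse (real (Suc n))"
proof -
  have "real (Suc n * Suc n) * inverse (real (Suc n)) = real (Suc n)" for n
    by (simp only: of_nat_mult) (simp add: field_simps)
  moreover have "\<forall>\<^sub>F n in sequentially. r < real (Suc n)"
    by real_asymp
  ultimately show ?thesis by (simp only:)
qed

text \<open>The process is a pointwise limit of step processes on a countable grid. Separate maps
  \<open>f\<close> and \<open>g\<close> let one statement cover random times (\<open>g\<close> the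
  identity) and joint measurability on a product space.\<close>

lemma right_continuous_process_measurable:
  fixes X :: "real \<Rightarrow> 'a \<Rightarrow> real"
  assumes X: "\<And>t. 0 \<le> t \<Longrightarrow> X t \<in> borel_measurable M"
    and cont: "\<And>\<omega> t. \<omega> \<in> space M \<Longrightarrow> 0 \<le> t \<Longrightarrow> continuous (at_right t) (\<lambda>t. X t \<omega>)"
    and f: "f \<in> borel_measurable A" "g \<in> measurable A M" "\<And>x. x \<in> space A \<Longrightarrow> 0 \<le> f x"
  shows "(\<lambda>x. X (f x) (g x)) \<in> borel_measurable A"
proof (rule borel_measurable_LIMSEQ_metric)
  let ?d = "\<lambda>n. inverse (real (Suc n))" and ?K = "\<lambda>n. Suc n * Suc n"
  fix x assume x: "x \<in> space A"
  show "(\<lambda>n. \<Sum>k<?K n. indicator {real k * ?d n..<(real k + 1) * ?d n} (f x) *\<^sub>R X ((real k + 1) * ?d n) (g x))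
      \<longlonglongrightarrow> X (f x) (g x)"
    using x f(3) cont[OF measurable_space[OF f(2) x]] LIMSEQ_inverse_real_of_nat
    by (intro step_approximation_tendsto eventually_less_mesh_bound) auto
next
  fix n :: nat
  have [measurable]: "X ((real k + 1) * inverse (real (Suc n))) \<in> borel_measurable M" for k
    by (rule X) simp
  note [measurable] = f(1,2)
  show "(\<lambda>x. \<Sum>k<Suc n * Suc n. indicator {real k * inverse (real (Suc n))..<(real k + 1) * inverse (real (Suc n))} (f x)
      *\<^sub>R X ((real k + 1) * inverse (real (Suc n))) (g x)) \<in> borel_measurable A"
    by measurable
qed

text \<open>Dominated convergence along sequences, with the constant \<open>K\<close> as
  majorant.\<close>

lemma (in prob_space) continuous_on_expectation:
  fixes X :: "real \<Rightarrow> 'a \<Rightarrow> 'b::metric_space" and \<psi> :: "'b \<Rightarrow> 'c::{banach, second_countable_topology}"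
  assumes X: "\<And>s. s \<in> S \<Longrightarrow> X s \<in> borel_measurable M"
    and paths: "\<And>\<omega>. \<omega> \<in> space M \<Longrightarrow> continuous_on S (\<lambda>s. X s \<omega>)"
    and \<psi>: "continuous_on UNIV \<psi>" "\<And>x. norm (\<psi> x) \<le> K"
  shows "continuous_on S (\<lambda>s. expectation (\<lambda>\<omega>. \<psi> (X s \<omega>)))"
  unfolding continuous_on_sequentially comp_def
proof safe
  fix x :: "nat \<Rightarrow> real" and a assume a: "a \<in> S" and x: "\<forall>n. x n \<in> S" and lim: "x \<longlonglongrightarrow> a"
  note [measurable] = X borel_measurable_continuous_onI[OF \<psi>(1)]
  show "(\<lambda>n. expectation (\<lambda>\<omega>. \<psi> (X (x n) \<omega>))) \<longlonglongrightarrow> expectation (\<lambda>\<omega>. \<psi> (X a \<omega>))"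
  proof (rule integral_dominated_convergence)
    show "AE \<omega> in M. (\<lambda>n. \<psi> (X (x n) \<omega>)) \<longlonglongrightarrow> \<psi> (X a \<omega>)"
    proof (rule AE_I2)
      fix \<omega> assume \<omega>: "\<omega> \<in> space M"
      have "(\<lambda>n. X (x n) \<omega>) \<longlonglongrightarrow> X a \<omega>"
        by (rule continuous_on_tendsto_compose[OF paths[OF \<omega>] lim a]) (use x in simp)
      then show "(\<lambda>n. \<psi> (X (x n) \<omega>)) \<longlonglongrightarrow> \<psi> (X a \<omega>)"
        using \<psi>(1) by (intro isCont_tendsto_compose[of _ \<psi>]) (auto simp: continuous_on_eq_continuous_at)
    qed
    show "(\<lambda>\<omega>. \<psi> (X a \<omega>)) \<in> borel_measurable M" using a by measurable
    show "(\<lambda>\<omega>. \<psi> (X (x n) \<omega>)) \<in> borel_measurable M" for n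
      by (rule measurable_compose[OF X borel_measurable_continuous_onI[OF \<psi>(1)]]) (use x in blast)
    show "integrable M (\<lambda>_. K)" by simp
    show "AE \<omega> in M. norm (\<psi> (X (x n) \<omega>)) \<le> K" for n using \<psi>(2) by simp
  qed
qed

text \<open>For a discrete time \<open>R\<close> this is the pairwise independence of \<open>X s\<close> and \<open>R\<close>; the general case
  follows by rounding \<open>R\<close> up to a grid, as the paths are continuous. Independence of \<open>R\<close> and the
  whole process \<open>X\<close> is not enough for a direct argument, since evaluation at a point is not jointly
  measurable on the product space over an uncountable index set.\<close>

lemma (in prob_space) expectation_at_independent_time:
  fixes X :: "real \<Rightarrow> 'a \<Rightarrow> real" and \<psi> :: "real \<Rightarrow> complex"
  assumes indep: "\<And>s. 0 \<le> s \<Longrightarrow> indep_var borel (X s) borel R"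
    and R: "\<And>\<omega>. \<omega> \<in> space M \<Longrightarrow> 0 \<le> R \<omega>"
    and paths: "\<And>\<omega>. \<omega> \<in> space M \<Longrightarrow> continuous_on {0..} (\<lambda>s. X s \<omega>)"
    and \<psi>: "continuous_on UNIV \<psi>" "\<And>x. norm (\<psi> x) \<le> K"
  shows "expectation (\<lambda>\<omega>. \<psi> (X (R \<omega>) \<omega>))
    = expectation (\<lambda>\<omega>. expectation (\<lambda>\<omega>'. \<psi> (X (R \<omega>) \<omega>')))"
proof -
  define h where "h s = expectation (\<lambda>\<omega>. \<psi> (X s \<omega>))" for s
  have X [measurable]: "X s \<in> borel_measurable M" if "0 \<le> s" for s
    using indep_var_rv1[OF indep[OF that]] .
  have R_meas [measurable]: "R \<in> borel_measurable M"
    using indep_var_rv2[OF indep[of 0]] by simp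
  note [measurable] = borel_measurable_continuous_onI[OF \<psi>(1)]
  have K: "0 \<le> K" using \<psi>(2)[of 0] norm_ge_zero order_trans by blast
  have h_cont: "continuous_on {0..} h"
    unfolding h_def using X paths \<psi> by (intro continuous_on_expectation) auto
  have h_bdd: "norm (h s) \<le> K" if "0 \<le> s" for s
    unfolding h_def using that X \<psi>(2)
    by (intro order_trans[OF integral_norm_bound] integral_le_const integrable_norm
        integrable_const_bound[where B=K]) auto
  have rc: "continuous (at_right r) u" if "continuous_on {0..} u" "0 \<le> r" for r and u :: "real \<Rightarrow> complex"
    using that by (auto simp: continuous_on_eq_continuous_within intro: continuous_within_subset)
  let ?d = "\<lambda>n. inverse (real (Suc n))" and ?K = "\<lambda>n. Suc n * Suc n"
  let ?I = "\<lambda>n k. indicator {real k * ?d n..<(real k + 1) * ?d n} :: real \<Rightarrow> real"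
  define S where "S u n r = (\<Sum>k<?K n. ?I n k r *\<^sub>R u ((real k + 1) * ?d n))" for u :: "real \<Rightarrow> complex" and n r
  have S_lim: "(\<lambda>n. S u n r) \<longlonglongrightarrow> u r" if "continuous_on {0..} u" "0 \<le> r" for u r
    unfolding S_def using that rc[OF that] LIMSEQ_inverse_real_of_nat
    by (intro step_approximation_tendsto eventually_less_mesh_bound) auto
  have S_bdd: "norm (S u n r) \<le> K" if "\<And>s. 0 \<le> s \<Longrightarrow> norm (u s) \<le> K" for u n r
    unfolding S_def using K that by (intro norm_step_le) auto
  have lim1: "(\<lambda>n. expectation (\<lambda>\<omega>. S (\<lambda>s. \<psi> (X s \<omega>)) n (R \<omega>))) \<longlonglongrightarrow> expectation (\<lambda>\<omega>. \<psi> (X (R \<omega>) \<omega>))"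
  proof (rule integral_dominated_convergence)
    have XR [measurable]: "(\<lambda>\<omega>. X (R \<omega>) \<omega>) \<in> borel_measurable M"
    proof (rule right_continuous_process_measurable[where X=X and f=R and g="\<lambda>\<omega>. \<omega>" and M=M])
      show "continuous (at_right t) (\<lambda>t. X t \<omega>)" if "\<omega> \<in> space M" "0 \<le> t" for \<omega> t
        using paths[OF that(1)] that(2)
        by (auto simp: continuous_on_eq_continuous_within intro: continuous_within_subset)
    qed (use R in auto)
    show "(\<lambda>\<omega>. \<psi> (X (R \<omega>) \<omega>)) \<in> borel_measurable M" by measurable
    show "(\<lambda>\<omega>. S (\<lambda>s. \<psi> (X s \<omega>)) n (R \<omega>)) \<in> borel_measurable M" for n
      unfolding S_def by measurable
    show "AE \<omega> in M. (\<lambda>n. S (\<lambda>s. \<psi> (X s \<omega>)) n (R \<omega>)) \<longlonglongrightarrow> \<psi> (X (R \<omega>) \<omega>)"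
      using R paths \<psi>(1) by (intro AE_I2 S_lim) (auto intro: continuous_on_compose2)
    show "AE \<omega> in M. norm (S (\<lambda>s. \<psi> (X s \<omega>)) n (R \<omega>)) \<le> K" for n
      using \<psi>(2) by (intro AE_I2 S_bdd) auto
  qed simp
  have lim2: "(\<lambda>n. expectation (\<lambda>\<omega>. S h n (R \<omega>))) \<longlonglongrightarrow> expectation (\<lambda>\<omega>. h (R \<omega>))"
  proof (rule integral_dominated_convergence)
    \<comment> \<open>Continuity of \<open>h\<close> is known only at nonnegative times, hence the
      cut-off, which is harmless since \<open>R\<close> is nonnegative.\<close>
    have "(\<lambda>x. indicator {0..} x *\<^sub>R h x) \<in> borel_measurable borel"
      by (rule borel_measurable_continuous_on_indicator[OF _ h_cont]) simp
    then have "(\<lambda>\<omega>. indicator {0..} (R \<omega>) *\<^sub>R h (R \<omega>)) \<in> borel_measurable M"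
      by measurable
    then show "(\<lambda>\<omega>. h (R \<omega>)) \<in> borel_measurable M"
      by (rule measurable_cong[THEN iffD1, rotated]) (simp add: R)
    show "(\<lambda>\<omega>. S h n (R \<omega>)) \<in> borel_measurable M" for n
      unfolding S_def by measurable
    show "AE \<omega> in M. (\<lambda>n. S h n (R \<omega>)) \<longlonglongrightarrow> h (R \<omega>)"
      using R h_cont by (intro AE_I2 S_lim) auto
    show "AE \<omega> in M. norm (S h n (R \<omega>)) \<le> K" for n
      using h_bdd by (intro AE_I2 S_bdd) auto
  qed simp
  \<comment> \<open>On the grid each summand is an indicator of \<open>R\<close> times a function of
    one \<open>X s\<close>, so pairwise independence factorizes it; the two limits must then
    agree.\<close>
  have "expectation (\<lambda>\<omega>. S (\<lambda>s. \<psi> (X s \<omega>)) n (R \<omega>)) = expectation (\<lambda>\<omega>. S h n (R \<omega>))" for n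
  proof -
    have term_eq: "expectation (\<lambda>\<omega>. ?I n k (R \<omega>) *\<^sub>R \<psi> (X s \<omega>)) = expectation (\<lambda>\<omega>. ?I n k (R \<omega>) *\<^sub>R h s)"
      if s: "0 \<le> s" for k s
    proof -
      have ind: "indep_var borel (\<lambda>\<omega>. \<psi> (X s \<omega>)) borel (\<lambda>\<omega>. complex_of_real (?I n k (R \<omega>)))"
        using indep_var_compose[OF indep[OF s], of \<psi> borel "\<lambda>r. complex_of_real (?I n k r)" borel]
        by (simp add: comp_def)
      have "expectation (\<lambda>\<omega>. \<psi> (X s \<omega>) * complex_of_real (?I n k (R \<omega>)))
          = h s * expectation (\<lambda>\<omega>. complex_of_real (?I n k (R \<omega>)))"
        unfolding h_def
      proof (rule indep_var_lebesgue_integral[OF ind])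
        show "integrable M (\<lambda>\<omega>. \<psi> (X s \<omega>))"
          using s \<psi>(2) by (intro integrable_const_bound[where B=K]) auto
        show "integrable M (\<lambda>\<omega>. complex_of_real (?I n k (R \<omega>)))"
          by (intro integrable_const_bound[where B=1]) (auto split: split_indicator)
      qed
      then show ?thesis by (simp add: scaleR_conv_of_real mult.commute)
    qed
    have int: "integrable M (\<lambda>\<omega>. ?I n k (R \<omega>) *\<^sub>R v \<omega>)"
      if "v \<in> borel_measurable M" "\<And>\<omega>. norm (v \<omega>) \<le> K" for k and v :: "'a \<Rightarrow> complex"
      using that K by (intro integrable_const_bound[where B=K]) (auto split: split_indicator)
    have "expectation (\<lambda>\<omega>. S (\<lambda>s. \<psi> (X s \<omega>)) n (R \<omega>))
        = (\<Sum>k<?K n. expectation (\<lambda>\<omega>. ?I n k (R \<omega>) *\<^sub>R \<psi> (X ((real k + 1) * ?d n) \<omega>)))"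
      unfolding S_def using \<psi>(2) by (intro Bochner_Integration.integral_sum int) auto
    also have "\<dots> = (\<Sum>k<?K n. expectation (\<lambda>\<omega>. ?I n k (R \<omega>) *\<^sub>R h ((real k + 1) * ?d n)))"
      by (intro sum.cong term_eq refl) simp
    also have "\<dots> = expectation (\<lambda>\<omega>. S h n (R \<omega>))"
      unfolding S_def using h_bdd by (intro Bochner_Integration.integral_sum[symmetric] int) auto
    finally show ?thesis .
  qed
  then have "expectation (\<lambda>\<omega>. \<psi> (X (R \<omega>) \<omega>)) = expectation (\<lambda>\<omega>. h (R \<omega>))"
    by (intro LIMSEQ_unique[OF lim1]) (simp only: lim2)
  then show ?thesis by (simp only: h_def)
qed

lemma (in prob_space) indep_processesD:
  assumes "indep_processes X Y" "0 \<le> s" "0 \<le> t"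
  shows "indep_var borel (X s) borel (Y t)"
  using indep_var_compose[OF assms(1)[unfolded indep_processes_def]
      measurable_component_singleton[of s] measurable_component_singleton[of t]] assms(2,3)
  by (simp add: comp_def)

text \<open>The truncation \<open>max 0\<close> is there because processes are jointly measurable at
  nonnegative times only; it has no effect on \<open>{0..x}\<close>.\<close>

lemma (in prob_space) expectation_set_integral_swap:
  fixes G :: "real \<Rightarrow> 'a \<Rightarrow> real"
  assumes meas: "(\<lambda>p. G (max 0 (fst p)) (snd p)) \<in> borel_measurable (lborel \<Otimes>\<^sub>M M)"
    and bdd: "\<And>r \<omega>. \<bar>G r \<omega>\<bar> \<le> K"
  shows "expectation (\<lambda>\<omega>. LBINT r:{0..x}. G r \<omega>) = (LBINT r:{0..x}. expectation (G r))"
proof -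
  have "emeasure (lborel \<Otimes>\<^sub>M M) ({0..x} \<times> space M) = emeasure lborel {0..x} * emeasure M (space M)"
    by (rule emeasure_pair_measure_Times) auto
  also have "\<dots> < \<infinity>"
    by (simp add: emeasure_space_1 emeasure_lborel_Icc_eq)
  finally have fin: "emeasure (lborel \<Otimes>\<^sub>M M) ({0..x} \<times> space M) < \<infinity>" .
  interpret pair_sigma_finite lborel M ..
  define f where "f r \<omega> = indicat_real {0..x} r * G (max 0 r) \<omega>" for r \<omega>
  have f: "f r \<omega> = indicat_real {0..x} r * G r \<omega>" for r \<omega>
    by (auto simp: f_def split: split_indicator)
  have "integrable (lborel \<Otimes>\<^sub>M M) (\<lambda>p. K * indicat_real ({0..x} \<times> space M) p)"
    using fin by (intro integrable_mult_right)
      (simp add: integrable_indicator_iff)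
  then have "integrable (lborel \<Otimes>\<^sub>M M) (case_prod f)"
  proof (rule Bochner_Integration.integrable_bound)
    have [measurable]: "(\<lambda>p. G (max 0 (fst p)) (snd p)) \<in> borel_measurable (borel \<Otimes>\<^sub>M M)"
      using meas by (simp add: measurable_def sets_pair_measure space_pair_measure)
    show "case_prod f \<in> borel_measurable (lborel \<Otimes>\<^sub>M M)"
      unfolding f_def case_prod_beta' using meas by measurable
    have "K \<ge> 0" using bdd[of 0 undefined] by simp
    then show "AE p in lborel \<Otimes>\<^sub>M M. norm (case_prod f p) \<le> norm (K * indicat_real ({0..x} \<times> space M) p)"
      using bdd by (intro AE_I2) (auto simp: f abs_mult space_pair_measure indicator_def)
  qed
  from Fubini_integral[OF this] show ?thesis
    by (simp add: f set_lebesgue_integral_def)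
qed

subsection \<open>The telegraph process\<close>

lemma sets_borel_nat: "sets (borel :: nat measure) = UNIV"
  by (auto intro: borel_open Topological_Spaces.open_discrete)

lemma at_within_Icc_plus_one: "0 < x \<Longrightarrow> at x within {0..x + 1 :: real} = at x"
  by (rule at_within_interior) auto

context poisson_process
begin

section \<open>The sign process and its time integral\<close>

definition flip :: "real \<Rightarrow> 'a \<Rightarrow> real" where
  "flip t \<omega> = (- 1) ^ N t \<omega>"

text \<open>The telegraph process with initial velocity 1. The random velocity is factored out so
  that its independence of \<open>N\<close> can be used once, at the end.\<close>

definition drift :: "real \<Rightarrow> 'a \<Rightarrow> real" where
  "drift t \<omega> = (LBINT s:{0..t}. flip s \<omega>)"

lemma abs_flip [simp]: "\<bar>flip t \<omega>\<bar> = 1"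
  by (simp add: flip_def)

text \<open>The topology of the naturals is discrete, so right-continuity of \<open>N\<close> means
  being constant immediately to the right.\<close>

lemma flip_right_continuous:
  assumes "\<omega> \<in> space M" "0 \<le> t"
  shows "continuous (at_right t) (\<lambda>t. flip t \<omega>)"
proof -
  have "\<forall>\<^sub>F s in at_right t. N s \<omega> = N t \<omega>"
    using N_right_continuous[OF assms]
    by (simp add: continuous_within nhds_discrete filterlim_principal)
  then have "\<forall>\<^sub>F s in at_right t. flip s \<omega> = flip t \<omega>"
    by eventually_elim (simp add: flip_def)
  then show ?thesis
    unfolding continuous_within by (rule tendsto_eventually)
qed

lemma flip_measurable:
  assumes "N t \<in> borel_measurable A"
  shows "flip t \<in> borel_measurable A"
  unfolding flip_def[abs_def]
  by (rule measurable_compose[OF assms]) (simp add: measurable_def sets_borel_nat)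

lemma flip_jointly_measurable [measurable (raw)]:
  assumes "f \<in> borel_measurable A" "g \<in> measurable A M" "\<And>x. x \<in> space A \<Longrightarrow> 0 \<le> f x"
  shows "(\<lambda>x. flip (f x) (g x)) \<in> borel_measurable A"
  using flip_measurable[OF measurable_N] flip_right_continuous assms
  by (rule right_continuous_process_measurable)

lemma flip_path_measurable:
  assumes "\<omega> \<in> space M" "S \<in> sets borel" "\<And>s. s \<in> S \<Longrightarrow> 0 \<le> s"
  shows "(\<lambda>s. indicator S s * flip s \<omega>) \<in> borel_measurable borel"
proof -
  have "(\<lambda>s. flip (max 0 s) \<omega>) \<in> borel_measurable borel"
    using assms(1) by (intro flip_jointly_measurable) auto
  then have "(\<lambda>s. indicator S s * flip (max 0 s) \<omega>) \<in> borel_measurable borel"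
    using assms(2) by measurable
  also have "(\<lambda>s. indicator S s * flip (max 0 s) \<omega>) = (\<lambda>s. indicator S s * flip s \<omega>)"
    using assms(3) by (auto simp: fun_eq_iff max_def split: split_indicator)
  finally show ?thesis .
qed

lemma flip_set_integrable:
  assumes "\<omega> \<in> space M" "0 \<le> a"
  shows "set_integrable lborel {a..b} (\<lambda>s. flip s \<omega>)"
  unfolding set_integrable_def
proof (rule Bochner_Integration.integrable_bound)
  show "integrable lborel (indicat_real {a..b})"
    by (simp add: integrable_indicator_iff emeasure_lborel_Icc_eq)
  show "(\<lambda>s. indicat_real {a..b} s *\<^sub>R flip s \<omega>) \<in> borel_measurable lborel"
    unfolding real_scaleR_def measurable_lborel2 by (rule flip_path_measurable[OF assms(1)]) (use assms(2) in auto)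
qed (auto simp: abs_mult)

lemma drift_eq_integral:
  assumes "\<omega> \<in> space M"
  shows "drift t \<omega> = integral {0..t} (\<lambda>s. flip s \<omega>)"
  unfolding drift_def using flip_set_integrable[OF assms order_refl]
  by (rule set_borel_integral_eq_integral)

lemma flip_integrable_on:
  assumes "\<omega> \<in> space M"
  shows "(\<lambda>s. flip s \<omega>) integrable_on {0..t}"
  using flip_set_integrable[OF assms order_refl] by (rule set_borel_integral_eq_integral)

lemma drift_continuous:
  assumes "\<omega> \<in> space M"
  shows "continuous_on {0..} (\<lambda>t. drift t \<omega>)"
  unfolding continuous_on_eq_continuous_within
proof
  fix t :: real assume t: "t \<in> {0..}"
  have "continuous_on {0..t + 1} (\<lambda>t. drift t \<omega>)"
    unfolding drift_eq_integral[OF assms]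
    by (rule indefinite_integral_continuous_1[OF flip_integrable_on[OF assms]])
  then have "continuous (at t within {0..t + 1}) (\<lambda>t. drift t \<omega>)"
    using t by (auto simp: continuous_on_eq_continuous_within)
  moreover have "at t within {0..t + 1} = at t within {0..}"
    by (rule at_within_nhd[of _ "{..<t + 1}"]) auto
  ultimately show "continuous (at t within {0..}) (\<lambda>t. drift t \<omega>)"
    by simp
qed

lemma drift_0 [simp]: "drift 0 \<omega> = 0"
proof -
  have "(\<lambda>s. indicat_real {0..0} s *\<^sub>R flip s \<omega>) = (\<lambda>s. indicat_real {0} s *\<^sub>R flip 0 \<omega>)"
    by (auto split: split_indicator)
  then show ?thesis by (simp add: drift_def set_lebesgue_integral_def)
qed

text \<open>The Riemann sums depend on finitely many values of \<open>N\<close> only, so that the independence of the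
  increments, which is stated for finite families, carries over to \<open>drift\<close> in the limit.\<close>

definition drift_approx :: "nat \<Rightarrow> real \<Rightarrow> 'a \<Rightarrow> real" where
  "drift_approx n x \<omega> = (\<Sum>k<Suc n. x / real (Suc n) * flip (x * real (Suc k) / real (Suc n)) \<omega>)"

text \<open>Each sum is the integral of a step function built from right end points.
  Right-continuity of \<open>flip\<close> gives pointwise convergence of these functions, and they
  are dominated by the indicator of \<open>{0..<x}\<close>.\<close>

lemma drift_approx_tendsto:
  assumes \<omega>: "\<omega> \<in> space M" and x: "0 \<le> x"
  shows "(\<lambda>n. drift_approx n x \<omega>) \<longlonglongrightarrow> drift x \<omega>"
proof (cases "x = 0")
  case True
  then show ?thesis by (simp add: drift_approx_def)
next
  case False
  with x have x: "0 < x" by simp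
  define d where "d n = x / real (Suc n)" for n
  define g where "g n r = (\<Sum>k<Suc n. indicator {real k * d n..<(real k + 1) * d n} r *\<^sub>R flip ((real k + 1) * d n) \<omega>)"
    for n and r :: real
  have d: "0 < d n" for n using x by (simp add: d_def)
  have xd: "real (Suc n) * d n = x" for n by (simp add: d_def)
  have g_0: "g n r = 0" if r: "r \<notin> {0..<x}" for n r
    unfolding g_def
  proof (rule sum.neutral, rule ballI)
    fix k assume "k \<in> {..<Suc n}"
    then have "(real k + 1) * d n \<le> real (Suc n) * d n"
      using d[of n] by (intro mult_right_mono) auto
    moreover have "0 \<le> real k * d n" using d[of n] by simp
    ultimately have "r \<notin> {real k * d n..<(real k + 1) * d n}"
      using r unfolding xd by auto
    then show "indicator {real k * d n..<(real k + 1) * d n} r *\<^sub>R flip ((real k + 1) * d n) \<omega> = 0"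
      by simp
  qed
  have int_g: "integral\<^sup>L lborel (g n) = drift_approx n x \<omega>" for n
  proof -
    have "integral\<^sup>L lborel (g n)
        = (\<Sum>k<Suc n. LBINT r. indicator {real k * d n..<(real k + 1) * d n} r *\<^sub>R flip ((real k + 1) * d n) \<omega>)"
      unfolding g_def using d[of n] by (intro Bochner_Integration.integral_sum integrable_scaleR_left) simp
    also have "\<dots> = drift_approx n x \<omega>"
      unfolding drift_approx_def
    proof (rule sum.cong)
      fix k
      have "x * real (Suc k) / real (Suc n) = (real k + 1) * d n" by (simp add: d_def)
      moreover have "measure lborel {real k * d n..<(real k + 1) * d n} = x / real (Suc n)"
        using d[of n] by (subst measure_lborel_Ico) (auto simp: distrib_right, simp add: d_def)
      ultimately show "(LBINT r. indicator {real k * d n..<(real k + 1) * d n} r *\<^sub>R flip ((real k + 1) * d n) \<omega>)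
          = x / real (Suc n) * flip (x * real (Suc k) / real (Suc n)) \<omega>"
        by (simp only: integral_scaleR_left integral_indicator) simp
    qed simp
    finally show ?thesis .
  qed
  have "(\<lambda>n. integral\<^sup>L lborel (g n)) \<longlonglongrightarrow> (LBINT r. indicator {0..<x} r * flip r \<omega>)"
  proof (rule integral_dominated_convergence)
    show "(\<lambda>r. indicator {0..<x} r * flip r \<omega>) \<in> borel_measurable lborel"
      unfolding real_scaleR_def measurable_lborel2 by (rule flip_path_measurable[OF \<omega>]) auto
    show "g n \<in> borel_measurable lborel" for n unfolding g_def by measurable
    show "integrable lborel (indicat_real {0..<x})" using x by simp
    show "AE r in lborel. (\<lambda>n. g n r) \<longlonglongrightarrow> indicator {0..<x} r * flip r \<omega>"
    proof (rule AE_I2)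
      fix r
      show "(\<lambda>n. g n r) \<longlonglongrightarrow> indicator {0..<x} r * flip r \<omega>"
      proof (cases "r \<in> {0..<x}")
        case True
        have "(\<lambda>n. g n r) \<longlonglongrightarrow> flip r \<omega>"
          unfolding g_def
        proof (rule step_approximation_tendsto)
          show "continuous (at_right r) (\<lambda>s. flip s \<omega>)" using True by (intro flip_right_continuous \<omega>) auto
          show "d \<longlonglongrightarrow> 0" unfolding d_def by real_asymp
          show "\<forall>\<^sub>F n in sequentially. r < real (Suc n) * d n" unfolding xd using True by simp
        qed (use True d in auto)
        then show ?thesis using True by simp
      next
        case False
        then show ?thesis using g_0 by simp
      qed
    qed
    show "AE r in lborel. norm (g n r) \<le> indicat_real {0..<x} r" for n
    proof (rule AE_I2)
      fix r
      show "norm (g n r) \<le> indicat_real {0..<x} r"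
      proof (cases "r \<in> {0..<x}")
        case True
        have "norm (g n r) \<le> 1"
          unfolding g_def
          by (rule norm_step_le[where v="\<lambda>k. flip ((real k + 1) * d n) \<omega>" and C=1, OF d]) auto
        moreover have "indicat_real {0..<x} r = 1"
          using True by simp
        ultimately show ?thesis by (simp only:)
      next
        case False
        then show ?thesis using g_0 by simp
      qed
    qed
  qed
  moreover have "(LBINT r. indicator {0..<x} r * flip r \<omega>) = drift x \<omega>"
    unfolding drift_def set_lebesgue_integral_def
  proof (rule integral_cong_AE)
    show "AE r in lborel. indicat_real {0..<x} r * flip r \<omega> = indicat_real {0..x} r *\<^sub>R flip r \<omega>"
      using AE_lborel_singleton[of x] by eventually_elim (auto split: split_indicator)
    show "(\<lambda>r. indicat_real {0..<x} r * flip r \<omega>) \<in> borel_measurable lborel"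
      unfolding real_scaleR_def measurable_lborel2 by (rule flip_path_measurable[OF \<omega>]) auto
    show "(\<lambda>r. indicat_real {0..x} r *\<^sub>R flip r \<omega>) \<in> borel_measurable lborel"
      unfolding real_scaleR_def measurable_lborel2 by (rule flip_path_measurable[OF \<omega>]) auto
  qed
  ultimately show ?thesis by (simp only: int_g)
qed

text \<open>The sigma-algebra is arbitrary so that the one generated by the paths of
  \<open>N\<close> is covered as well; independence of \<open>N\<close> and \<open>V\<close> is
  stated for that one.\<close>

lemma drift_measurable:
  assumes "space A = space M" "\<And>t. 0 \<le> t \<Longrightarrow> N t \<in> borel_measurable A" and x: "0 \<le> x"
  shows "drift x \<in> borel_measurable A"
proof (rule borel_measurable_LIMSEQ_real)
  fix n
  have "flip (x * real (Suc k) / real (Suc n)) \<in> borel_measurable A" for k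
    using x by (intro flip_measurable assms(2)) auto
  then show "drift_approx n x \<in> borel_measurable A"
    unfolding drift_approx_def by measurable
qed (use drift_approx_tendsto[OF _ x] assms(1) in auto)

lemma drift_jointly_measurable [measurable (raw)]:
  assumes "f \<in> borel_measurable A" "g \<in> measurable A M" "\<And>x. x \<in> space A \<Longrightarrow> 0 \<le> f x"
  shows "(\<lambda>x. drift (f x) (g x)) \<in> borel_measurable A"
proof (rule right_continuous_process_measurable[OF _ _ assms])
  show "continuous (at_right t) (\<lambda>t. drift t \<omega>)" if "\<omega> \<in> space M" "0 \<le> t" for t \<omega>
    using drift_continuous[OF that(1)] that(2)
    by (auto simp: continuous_on_eq_continuous_within intro: continuous_within_subset)
qed (use drift_measurable[OF refl measurable_N] in auto)

section \<open>Decorrelation of the sign\<close>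

text \<open>The Poisson generating function exp(r(z-1)) at z = -1. This is where the constant
  \<open>2 * rate\<close> originates.\<close>

lemma expectation_flip_increment:
  assumes "0 \<le> s" "s < y"
  shows "expectation (\<lambda>\<omega>. (- 1 :: real) ^ (N y \<omega> - N s \<omega>)) = exp (- (2 * rate * (y - s)))"
proof -
  define r where "r = rate * (y - s)"
  have r: "0 < r" using rate_pos assms by (simp add: r_def)
  have [measurable]: "(\<lambda>\<omega>. N y \<omega> - N s \<omega>) \<in> measurable M (count_space UNIV)"
  proof -
    have [measurable]: "N y \<in> measurable M (count_space UNIV)" "N s \<in> measurable M (count_space UNIV)"
      using measurable_N[of y] measurable_N[of s] assms by (simp_all add: measurable_def sets_borel_nat)
    show ?thesis by measurable
  qed
  have "expectation (\<lambda>\<omega>. (- 1 :: real) ^ (N y \<omega> - N s \<omega>))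
      = (\<integral>k. (- 1 :: real) ^ k \<partial>distr M (count_space UNIV) (\<lambda>\<omega>. N y \<omega> - N s \<omega>))"
    using integral_distr[of "\<lambda>\<omega>. N y \<omega> - N s \<omega>" M "count_space UNIV" "\<lambda>k. (- 1 :: real) ^ k"] by simp
  also have "\<dots> = (\<integral>k. (- 1 :: real) ^ k \<partial>measure_pmf (poisson_pmf r))"
    unfolding r_def using N_poisson[OF assms] by simp
  also have "\<dots> = (\<integral>k. pmf (poisson_pmf r) k *\<^sub>R (- 1 :: real) ^ k \<partial>count_space UNIV)"
    unfolding measure_pmf_eq_density by (subst integral_density) auto
  also have "\<dots> = (\<Sum>k. pmf (poisson_pmf r) k *\<^sub>R (- 1 :: real) ^ k)"
  proof (rule sums_unique[OF sums_integral_count_space_nat])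
    have "integrable (measure_pmf (poisson_pmf r)) (\<lambda>k. (- 1) ^ k :: real)"
      by (intro measure_pmf.integrable_const_bound[where B=1]) auto
    then show "integrable (count_space UNIV) (\<lambda>k. pmf (poisson_pmf r) k *\<^sub>R (- 1 :: real) ^ k)"
      unfolding measure_pmf_eq_density by (subst (asm) integrable_density) auto
  qed
  also have "\<dots> = (\<Sum>k. exp (- r) * ((- r) ^ k /\<^sub>R fact k))"
    using r by (simp add: power_minus[of r] field_simps)
  also have "\<dots> = exp (- r) * exp (- r)"
    by (intro sums_unique[symmetric] sums_mult exp_converges)
  also have "\<dots> = exp (- (2 * rate * (y - s)))"
    by (simp add: exp_add[symmetric] r_def)
  finally show ?thesis .
qed


text \<open>A sign is its own inverse, so the product sees only the increment after
  \<open>s\<close>, the part that is independent of the past.\<close>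

lemma flip_mult:
  assumes "\<omega> \<in> space M" "0 \<le> s" "s \<le> y"
  shows "flip s \<omega> * flip y \<omega> = (- 1) ^ (N y \<omega> - N s \<omega>)"
proof -
  have "N s \<omega> \<le> N y \<omega>" using N_mono[OF assms(1)] assms(2,3) by (auto simp: mono_on_def)
  then have "(- 1 :: real) ^ N y \<omega> = (- 1) ^ N s \<omega> * (- 1) ^ (N y \<omega> - N s \<omega>)"
    by (simp add: power_add[symmetric])
  then show ?thesis by (simp add: flip_def mult.assoc[symmetric] power_mult_distrib[symmetric])
qed

text \<open>The first factor depends on the past up to \<open>s\<close>, the product of signs on the
  increment from \<open>s\<close> to \<open>y\<close>. The factorization is proved for Riemann sums
  and passes to the limit by bounded convergence.\<close>

lemma expectation_drift_flip:
  fixes \<phi> :: "real \<Rightarrow> real"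
  assumes s: "0 \<le> s" "s < y" and \<phi>: "continuous_on UNIV \<phi>" "\<And>x. \<bar>\<phi> x\<bar> \<le> K"
  shows "expectation (\<lambda>\<omega>. \<phi> (drift s \<omega>) * (flip s \<omega> * flip y \<omega>))
    = expectation (\<lambda>\<omega>. \<phi> (drift s \<omega>)) * exp (- (2 * rate * (y - s)))"
proof -
  note [measurable] = borel_measurable_continuous_onI[OF \<phi>(1)]
  have \<phi>_lim: "(\<lambda>n. \<phi> (drift_approx n s \<omega>)) \<longlonglongrightarrow> \<phi> (drift s \<omega>)" if "\<omega> \<in> space M" for \<omega>
    using \<phi>(1) drift_approx_tendsto[OF that s(1)]
    by (intro isCont_tendsto_compose[of _ \<phi>]) (auto simp: continuous_on_eq_continuous_at)
  have [measurable]: "flip s \<in> borel_measurable M" "flip y \<in> borel_measurable M" "drift s \<in> borel_measurable M"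
    using s by (auto intro!: flip_measurable drift_measurable measurable_N)
  have approx_meas [measurable]: "drift_approx n s \<in> borel_measurable M" for n
  proof -
    have "flip (s * real (Suc k) / real (Suc n)) \<in> borel_measurable M" for k
      using s by (intro flip_measurable measurable_N) auto
    then show ?thesis unfolding drift_approx_def by measurable
  qed
  have step: "expectation (\<lambda>\<omega>. \<phi> (drift_approx n s \<omega>) * (flip s \<omega> * flip y \<omega>))
      = expectation (\<lambda>\<omega>. \<phi> (drift_approx n s \<omega>)) * exp (- (2 * rate * (y - s)))" for n
  proof -
    \<comment> \<open>the mesh on \<open>[0, s]\<close>, followed by the single increment from \<open>s\<close> to \<open>y\<close>\<close>
    define \<tau> where "\<tau> i = (if i \<le> Suc n then s * real i / real (Suc n) else y)" for i
    define \<Delta> where "\<Delta> i \<omega> = N (\<tau> (Suc i)) \<omega> - N (\<tau> i) \<omega>" for i \<omega>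
    have \<tau>_last: "\<tau> (Suc n) = s" "\<tau> (Suc (Suc n)) = y" by (simp_all add: \<tau>_def)
    have \<tau>_nonneg: "0 \<le> \<tau> i" for i using s by (simp add: \<tau>_def)
    have \<tau>_le: "\<tau> i \<le> \<tau> (Suc i)" for i
    proof (cases "Suc i \<le> Suc n")
      case True
      then show ?thesis using s by (auto simp: \<tau>_def intro!: divide_right_mono mult_left_mono)
    next
      case False
      have "\<tau> i \<le> y"
      proof (cases "i \<le> Suc n")
        case True
        then have "s * (real i / real (Suc n)) \<le> s * 1"
          using s by (intro mult_left_mono) auto
        with True show ?thesis using s by (simp add: \<tau>_def)
      qed (simp add: \<tau>_def)
      with False show ?thesis by (simp add: \<tau>_def)
    qed
    have ind: "indep_vars (\<lambda>_. borel) \<Delta> {..<Suc (Suc n)}"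
      unfolding \<Delta>_def
      using N_increments \<tau>_nonneg[of 0] incseq_SucI[of \<tau>, OF \<tau>_le] unfolding independent_increments_def by blast
    have tele: "N (\<tau> i) \<omega> = (\<Sum>j<i. \<Delta> j \<omega>)" if "\<omega> \<in> space M" for i \<omega>
    proof (induction i)
      case 0
      then show ?case using N_0[OF that] by (simp add: \<tau>_def)
    next
      case (Suc i)
      have "N (\<tau> i) \<omega> \<le> N (\<tau> (Suc i)) \<omega>"
        using N_mono[OF that] \<tau>_le[of i] \<tau>_nonneg[of i] \<tau>_nonneg[of "Suc i"] by (auto simp: mono_on_def)
      then show ?case using Suc by (simp add: \<Delta>_def)
    qed
    \<comment> \<open>\<open>Y1\<close> rebuilds the Riemann sum from the mesh increments, as (-1)^N
      at a mesh point is the product of the signs of all earlier increments; \<open>Y2\<close> reads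
      only the increment with index \<open>Suc n\<close>, from \<open>s\<close> to
      \<open>y\<close>.\<close>
    define Y1 where "Y1 f = \<phi> (\<Sum>k<Suc n. s / real (Suc n) * (\<Prod>j<Suc k. (- 1) ^ (f j :: nat)))" for f :: "nat \<Rightarrow> nat"
    define Y2 where "Y2 f = (- 1 :: real) ^ (f (Suc n) :: nat)" for f :: "nat \<Rightarrow> nat"
    have sgn: "(\<lambda>m::nat. (- 1 :: real) ^ m) \<in> borel_measurable borel"
      by (simp add: measurable_def sets_borel_nat)
    have comp: "(\<lambda>f. (- 1 :: real) ^ (f j :: nat)) \<in> borel_measurable (PiM A (\<lambda>_. borel))" if "j \<in> A" for j A
      using that by (intro measurable_compose[OF measurable_component_singleton[of j A "\<lambda>_. borel"] sgn])
    have "indep_var borel (Y1 \<circ> (\<lambda>\<omega>. restrict (\<lambda>i. \<Delta> i \<omega>) {..<Suc n}))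
        borel (Y2 \<circ> (\<lambda>\<omega>. restrict (\<lambda>i. \<Delta> i \<omega>) {Suc n}))"
    proof (rule indep_var_compose[OF indep_var_restrict[OF ind]])
      show "Y1 \<in> borel_measurable (PiM {..<Suc n} (\<lambda>_. borel))"
        unfolding Y1_def
        by (intro measurable_compose[OF _ borel_measurable_continuous_onI[OF \<phi>(1)]]
            borel_measurable_sum borel_measurable_times borel_measurable_prod borel_measurable_const comp) auto
      show "Y2 \<in> borel_measurable (PiM {Suc n} (\<lambda>_. borel))"
        unfolding Y2_def by (rule comp) simp
    qed auto
    then have "expectation (\<lambda>\<omega>. (Y1 \<circ> (\<lambda>\<omega>. restrict (\<lambda>i. \<Delta> i \<omega>) {..<Suc n})) \<omega>
          * (Y2 \<circ> (\<lambda>\<omega>. restrict (\<lambda>i. \<Delta> i \<omega>) {Suc n})) \<omega>)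
        = expectation (Y1 \<circ> (\<lambda>\<omega>. restrict (\<lambda>i. \<Delta> i \<omega>) {..<Suc n}))
          * expectation (Y2 \<circ> (\<lambda>\<omega>. restrict (\<lambda>i. \<Delta> i \<omega>) {Suc n}))"
    proof (rule indep_var_lebesgue_integral)
      show "integrable M (Y1 \<circ> (\<lambda>\<omega>. restrict (\<lambda>i. \<Delta> i \<omega>) {..<Suc n}))"
        using indep_var_rv1[OF \<open>indep_var borel _ borel _\<close>] \<phi>(2)
        by (intro integrable_const_bound[where B=K]) (auto simp: Y1_def)
      show "integrable M (Y2 \<circ> (\<lambda>\<omega>. restrict (\<lambda>i. \<Delta> i \<omega>) {Suc n}))"
        using indep_var_rv2[OF \<open>indep_var borel _ borel _\<close>]
        by (intro integrable_const_bound[where B=1]) (auto simp: Y2_def)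
    qed
    moreover have "Y1 (restrict (\<lambda>i. \<Delta> i \<omega>) {..<Suc n}) = \<phi> (drift_approx n s \<omega>)" if "\<omega> \<in> space M" for \<omega>
    proof -
      have "(\<Prod>j<Suc k. (- 1) ^ (restrict (\<lambda>i. \<Delta> i \<omega>) {..<Suc n} j))
          = flip (s * real (Suc k) / real (Suc n)) \<omega>" if k: "k < Suc n" for k
      proof -
        have "(\<Prod>j<Suc k. (- 1 :: real) ^ (restrict (\<lambda>i. \<Delta> i \<omega>) {..<Suc n} j)) = (\<Prod>j<Suc k. (- 1) ^ \<Delta> j \<omega>)"
          using k by (intro prod.cong) auto
        also have "\<dots> = (- 1) ^ N (\<tau> (Suc k)) \<omega>"
          unfolding tele[OF \<open>\<omega> \<in> space M\<close>] power_sum ..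
        also have "\<dots> = flip (s * real (Suc k) / real (Suc n)) \<omega>"
          using k by (simp add: flip_def \<tau>_def)
        finally show ?thesis .
      qed
      then show ?thesis unfolding Y1_def drift_approx_def by (auto intro!: arg_cong[of _ _ \<phi>] sum.cong)
    qed
    moreover have "Y2 (restrict (\<lambda>i. \<Delta> i \<omega>) {Suc n}) = (- 1) ^ (N y \<omega> - N s \<omega>)" for \<omega>
      by (simp add: Y2_def \<Delta>_def \<tau>_last)
    ultimately have "expectation (\<lambda>\<omega>. \<phi> (drift_approx n s \<omega>) * (- 1) ^ (N y \<omega> - N s \<omega>))
        = expectation (\<lambda>\<omega>. \<phi> (drift_approx n s \<omega>)) * expectation (\<lambda>\<omega>. (- 1) ^ (N y \<omega> - N s \<omega>))"
      by (simp add: comp_def cong: Bochner_Integration.integral_cong)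
    then show ?thesis
      using s flip_mult expectation_flip_increment[OF s]
      by (simp cong: Bochner_Integration.integral_cong)
  qed
  have "(\<lambda>n. expectation (\<lambda>\<omega>. \<phi> (drift_approx n s \<omega>) * (flip s \<omega> * flip y \<omega>)))
      \<longlonglongrightarrow> expectation (\<lambda>\<omega>. \<phi> (drift s \<omega>) * (flip s \<omega> * flip y \<omega>))"
    using \<phi>(2) \<phi>_lim
    by (intro integral_dominated_convergence[where w="\<lambda>_. K"]) (auto simp: abs_mult intro!: tendsto_intros)
  moreover have "(\<lambda>n. expectation (\<lambda>\<omega>. \<phi> (drift_approx n s \<omega>)) * exp (- (2 * rate * (y - s))))
      \<longlonglongrightarrow> expectation (\<lambda>\<omega>. \<phi> (drift s \<omega>)) * exp (- (2 * rate * (y - s)))"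
    using \<phi>(2) \<phi>_lim
    by (intro tendsto_mult_right integral_dominated_convergence[where w="\<lambda>_. K"]) auto
  ultimately show ?thesis
    unfolding step by (rule LIMSEQ_unique)
qed

section \<open>Calculus along the paths\<close>

text \<open>\<open>N\<close> takes different values at different such points, for otherwise it would
  be constant on the interval between them; all these values are natural numbers bounded by
  \<open>N x\<close>.\<close>

lemma finite_jumps:
  assumes \<omega>: "\<omega> \<in> space M"
  shows "finite {t \<in> {0<..<x}. \<not> (\<forall>\<^sub>F s in at_left t. N s \<omega> = N t \<omega>)}" (is "finite ?S")
proof (rule finite_imageD)
  have mono: "N s \<omega> \<le> N t \<omega>" if "0 \<le> s" "s \<le> t" for s t
    using N_mono[OF \<omega>] that by (auto simp: mono_on_def)
  show "finite ((\<lambda>t. N t \<omega>) ` ?S)"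
    by (rule finite_subset[of _ "{..N x \<omega>}"]) (auto intro!: mono)
  have "N a \<omega> \<noteq> N b \<omega>" if ab: "a \<in> ?S" "b \<in> ?S" "a < b" for a b
  proof
    assume eq: "N a \<omega> = N b \<omega>"
    have "N s \<omega> = N b \<omega>" if "a < s" "s < b" for s
      using mono[of a s] mono[of s b] ab that eq by auto
    then have "\<forall>\<^sub>F s in at_left b. N s \<omega> = N b \<omega>"
      using ab(3) by (auto simp: eventually_at_left[OF ab(3)])
    with ab(2) show False by simp
  qed
  then show "inj_on (\<lambda>t. N t \<omega>) ?S"
    by (intro linorder_inj_onI') auto
qed

lemma drift_has_derivative:
  assumes \<omega>: "\<omega> \<in> space M" and t: "0 < t" and left: "\<forall>\<^sub>F s in at_left t. N s \<omega> = N t \<omega>"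
  shows "((\<lambda>t. drift t \<omega>) has_real_derivative flip t \<omega>) (at t)"
proof -
  have "\<forall>\<^sub>F s in at_right t. N s \<omega> = N t \<omega>"
    using N_right_continuous[OF \<omega>, of t] t
    by (simp add: continuous_within nhds_discrete filterlim_principal)
  with left have "\<forall>\<^sub>F s in at t. N s \<omega> = N t \<omega>"
    by (simp add: eventually_at_split)
  then have "\<forall>\<^sub>F s in at t. flip s \<omega> = flip t \<omega>"
    by eventually_elim (simp add: flip_def)
  then have "isCont (\<lambda>s. flip s \<omega>) t"
    unfolding isCont_def by (rule tendsto_eventually)
  \<comment> \<open>The interval reaches beyond \<open>t\<close> to make \<open>t\<close> an
    interior point.\<close>
  then have "((\<lambda>u. integral {0..u} (\<lambda>s. flip s \<omega>)) has_vector_derivative flip t \<omega>) (at t within {0..t + 1} - {})"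
    using t flip_integrable_on[OF \<omega>]
    by (intro integral_has_vector_derivative_continuous_at) (auto intro: continuous_at_imp_continuous_at_within)
  moreover have "at t within {0..t + 1} - {} = at t"
    using t by (subst at_within_interior) auto
  ultimately show ?thesis
    by (simp only: drift_eq_integral[OF \<omega>] has_real_derivative_iff_has_vector_derivative)
qed

text \<open>The path has corners at the jumps of \<open>N\<close>. The fundamental theorem is
  applied in the form that tolerates a finite exceptional set for a continuous function.\<close>

lemma drift_FTC:
  fixes F F' :: "real \<Rightarrow> real"
  assumes \<omega>: "\<omega> \<in> space M" and x: "0 \<le> x"
    and F: "\<And>z. (F has_real_derivative F' z) (at z)"
    and F': "continuous_on UNIV F'" "\<And>z. \<bar>F' z\<bar> \<le> K"
  shows "F (drift x \<omega>) - F 0 = (LBINT r:{0..x}. F' (drift r \<omega>) * flip r \<omega>)"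
proof -
  have "((\<lambda>r. F' (drift r \<omega>) * flip r \<omega>) has_integral (F (drift x \<omega>) - F (drift 0 \<omega>))) {0..x}"
  proof (rule fundamental_theorem_of_calculus_interior_strong[OF finite_jumps[OF \<omega>, of x] x])
    show "((\<lambda>t. F (drift t \<omega>)) has_vector_derivative F' (drift t \<omega>) * flip t \<omega>) (at t)"
      if "t \<in> {0<..<x} - {t \<in> {0<..<x}. \<not> (\<forall>\<^sub>F s in at_left t. N s \<omega> = N t \<omega>)}" for t
      unfolding has_real_derivative_iff_has_vector_derivative[symmetric]
      using that by (intro DERIV_chain2[OF F] drift_has_derivative \<omega>) auto
    have "continuous_on UNIV F"
      using F by (auto intro!: continuous_at_imp_continuous_on DERIV_isCont)
    then show "continuous_on {0..x} (\<lambda>t. F (drift t \<omega>))"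
      by (rule continuous_on_compose2) (auto intro: continuous_on_subset[OF drift_continuous[OF \<omega>]])
  qed
  moreover have "set_integrable lborel {0..x} (\<lambda>r. F' (drift r \<omega>) * flip r \<omega>)"
    unfolding set_integrable_def
  proof (rule Bochner_Integration.integrable_bound)
    show "integrable lborel (\<lambda>r. K * indicat_real {0..x} r)"
      by (simp add: integrable_indicator_iff emeasure_lborel_Icc_eq)
    have "(\<lambda>r. indicat_real {0..x} r * (F' (drift (max 0 r) \<omega>) * flip (max 0 r) \<omega>)) \<in> borel_measurable borel"
      using \<omega> borel_measurable_continuous_onI[OF F'(1)]
      by (intro borel_measurable_times flip_jointly_measurable
          measurable_compose[OF drift_jointly_measurable borel_measurable_continuous_onI[OF F'(1)]]) auto
    also have "(\<lambda>r. indicat_real {0..x} r * (F' (drift (max 0 r) \<omega>) * flip (max 0 r) \<omega>))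
        = (\<lambda>r. indicat_real {0..x} r *\<^sub>R (F' (drift r \<omega>) * flip r \<omega>))"
      by (auto simp: fun_eq_iff split: split_indicator)
    finally show "(\<lambda>r. indicat_real {0..x} r *\<^sub>R (F' (drift r \<omega>) * flip r \<omega>)) \<in> borel_measurable lborel"
      by simp
    show "AE r in lborel. norm (indicat_real {0..x} r *\<^sub>R (F' (drift r \<omega>) * flip r \<omega>)) \<le> norm (K * indicat_real {0..x} r)"
      using F'(2) order_trans[OF F'(2) abs_ge_self] by (intro AE_I2) (auto simp: abs_mult split: split_indicator)
  qed
  ultimately show ?thesis
    using set_borel_integral_eq_integral(2) by (metis (no_types, lifting) drift_0 integral_unique)
qed


section \<open>The linear system for the means and its Laplace transform\<close>

text \<open>For \<open>k = \<xi> * c\<close> this is the characteristic function of the telegraph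
  process, real because the initial velocity is symmetric.\<close>

definition cos_mean :: "real \<Rightarrow> real \<Rightarrow> real" where
  "cos_mean k x = expectation (\<lambda>\<omega>. cos (k * drift x \<omega>))"

text \<open>Differentiating the cosine mean brings out the current sign; weighting the sine by it
  closes the system to two equations.\<close>

definition sin_mean :: "real \<Rightarrow> real \<Rightarrow> real" where
  "sin_mean k x = expectation (\<lambda>\<omega>. sin (k * drift x \<omega>) * flip x \<omega>)"

lemma abs_cos_mean_le: "\<bar>cos_mean k x\<bar> \<le> 1"
proof -
  have "\<bar>cos_mean k x\<bar> \<le> expectation (\<lambda>\<omega>. 1)"
    unfolding cos_mean_def
    by (rule order_trans[OF integral_abs_bound]) (rule integral_mono', auto)
  then show ?thesis by (simp add: prob_space)
qed

lemma abs_sin_mean_le: "\<bar>sin_mean k x\<bar> \<le> 1"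
proof -
  have "\<bar>sin_mean k x\<bar> \<le> expectation (\<lambda>\<omega>. 1)"
    unfolding sin_mean_def
    by (rule order_trans[OF integral_abs_bound]) (rule integral_mono', auto simp: abs_mult)
  then show ?thesis by (simp add: prob_space)
qed

lemma cos_mean_0 [simp]: "cos_mean k 0 = 1" and sin_mean_0 [simp]: "sin_mean k 0 = 0"
  by (simp_all add: cos_mean_def sin_mean_def prob_space)

lemma cos_mean_continuous: "continuous_on {0..} (cos_mean k)"
  unfolding cos_mean_def[abs_def]
  using drift_continuous
  by (intro continuous_on_expectation[where \<psi>="\<lambda>x. cos (k * x)" and K=1])
    (auto intro!: continuous_intros drift_measurable measurable_N)

lemma drift_fst_snd_measurable:
  "(\<lambda>p. drift (max 0 (fst p)) (snd p)) \<in> borel_measurable (lborel \<Otimes>\<^sub>M M)"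
  "(\<lambda>p. flip (max 0 (fst p)) (snd p)) \<in> borel_measurable (lborel \<Otimes>\<^sub>M M)"
  by (intro drift_jointly_measurable flip_jointly_measurable; simp)+

text \<open>The integrated form of C' = - k S: \<open>drift_FTC\<close> for the cosine, then Fubini.
  Continuity of S is still to be derived, so no derivative can be stated yet.\<close>

lemma cos_mean_eq:
  assumes x: "0 \<le> x"
  shows "cos_mean k x = 1 - k * (LBINT r:{0..x}. sin_mean k r)"
proof -
  note [measurable] = drift_fst_snd_measurable
  have "cos_mean k x - 1 = expectation (\<lambda>\<omega>. cos (k * drift x \<omega>) - 1)"
    unfolding cos_mean_def using x
    by (subst Bochner_Integration.integral_diff)
      (auto simp: prob_space intro!: integrable_const_bound[where B=1] drift_measurable measurable_N
        measurable_compose[OF _ borel_measurable_continuous_onI[of "\<lambda>z. cos (k * z)"]] continuous_intros)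
  also have "\<dots> = expectation (\<lambda>\<omega>. LBINT r:{0..x}. - k * sin (k * drift r \<omega>) * flip r \<omega>)"
  proof (rule Bochner_Integration.integral_cong[OF refl])
    fix \<omega> assume \<omega>: "\<omega> \<in> space M"
    have "cos (k * drift x \<omega>) - cos (k * 0) = (LBINT r:{0..x}. (- k * sin (k * drift r \<omega>)) * flip r \<omega>)"
      by (rule drift_FTC[OF \<omega> x, where F="\<lambda>z. cos (k * z)" and F'="\<lambda>z. - k * sin (k * z)" and K="\<bar>k\<bar>"])
        (auto intro!: derivative_eq_intros continuous_intros simp: abs_mult mult_left_le)
    then show "cos (k * drift x \<omega>) - 1 = (LBINT r:{0..x}. - k * sin (k * drift r \<omega>) * flip r \<omega>)"
      by simp
  qed
  also have "\<dots> = (LBINT r:{0..x}. expectation (\<lambda>\<omega>. - k * sin (k * drift r \<omega>) * flip r \<omega>))"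
    by (rule expectation_set_integral_swap[where K="\<bar>k\<bar>"])
      (measurable, auto simp: abs_mult mult_left_le)
  also have "\<dots> = (LBINT r:{0..x}. - k * sin_mean k r)"
    by (simp add: sin_mean_def mult.assoc)
  also have "\<dots> = - k * (LBINT r:{0..x}. sin_mean k r)"
    by (rule set_integral_mult_right)
  finally show ?thesis by simp
qed

text \<open>The Duhamel form of S' = k C - 2 rate S. The terminal sign \<open>flip y\<close> is
  moved into the path integral, where together with \<open>flip r\<close> it decorrelates from the
  drift up to \<open>r\<close>.\<close>

lemma sin_mean_eq:
  assumes y: "0 \<le> y"
  shows "sin_mean k y = k * (LBINT r:{0..y}. cos_mean k r * exp (- (2 * rate * (y - r))))"
proof -
  note [measurable] = drift_fst_snd_measurable
  have [measurable]: "flip y \<in> borel_measurable M"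
    using y by (intro flip_measurable measurable_N)
  have "sin_mean k y = expectation (\<lambda>\<omega>. LBINT r:{0..y}. k * (cos (k * drift r \<omega>) * (flip r \<omega> * flip y \<omega>)))"
    unfolding sin_mean_def
  proof (rule Bochner_Integration.integral_cong[OF refl])
    fix \<omega> assume \<omega>: "\<omega> \<in> space M"
    have "sin (k * drift y \<omega>) - sin (k * 0) = (LBINT r:{0..y}. (k * cos (k * drift r \<omega>)) * flip r \<omega>)"
      by (rule drift_FTC[OF \<omega> y, where F="\<lambda>z. sin (k * z)" and F'="\<lambda>z. k * cos (k * z)" and K="\<bar>k\<bar>"])
        (auto intro!: derivative_eq_intros continuous_intros simp: abs_mult mult_left_le)
    then have "sin (k * drift y \<omega>) * flip y \<omega> = (LBINT r:{0..y}. (k * cos (k * drift r \<omega>)) * flip r \<omega> * flip y \<omega>)"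
      by simp
    then show "sin (k * drift y \<omega>) * flip y \<omega>
        = (LBINT r:{0..y}. k * (cos (k * drift r \<omega>) * (flip r \<omega> * flip y \<omega>)))"
      by (simp add: mult.assoc)
  qed
  also have "\<dots> = (LBINT r:{0..y}. expectation (\<lambda>\<omega>. k * (cos (k * drift r \<omega>) * (flip r \<omega> * flip y \<omega>))))"
    by (rule expectation_set_integral_swap[where K="\<bar>k\<bar>"])
      (measurable, auto simp: abs_mult mult_left_le)
  also have "\<dots> = (LBINT r:{0..y}. k * (cos_mean k r * exp (- (2 * rate * (y - r)))))"
  proof (rule set_lebesgue_integral_cong)
    have "expectation (\<lambda>\<omega>. cos (k * drift r \<omega>) * (flip r \<omega> * flip y \<omega>))
        = cos_mean k r * exp (- (2 * rate * (y - r)))" if "0 \<le> r" "r \<le> y" for r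
    \<comment> \<open>The end point is separate because \<open>expectation_drift_flip\<close>
      requires a positive time difference.\<close>
    proof (cases "r = y")
      case True
      have "flip y \<omega> * flip y \<omega> = 1" for \<omega>
        by (simp add: flip_def power_mult_distrib[symmetric])
      then show ?thesis using True by (simp add: cos_mean_def)
    next
      case False
      with that show ?thesis
        unfolding cos_mean_def
        by (intro expectation_drift_flip[where \<phi>="\<lambda>z. cos (k * z)" and K=1]) (auto intro!: continuous_intros)
    qed
    then show "\<forall>r. r \<in> {0..y} \<longrightarrow> expectation (\<lambda>\<omega>. k * (cos (k * drift r \<omega>) * (flip r \<omega> * flip y \<omega>)))
        = k * (cos_mean k r * exp (- (2 * rate * (y - r))))"
      by simp
  qed simp
  also have "\<dots> = k * (LBINT r:{0..y}. cos_mean k r * exp (- (2 * rate * (y - r))))"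
    by (rule set_integral_mult_right)
  finally show ?thesis .
qed

text \<open>Splitting the exponential frees the integrand of \<open>y\<close>, so that the product
  rule applies.\<close>

lemma sin_mean_eq_integral:
  assumes y: "0 \<le> y"
  shows "sin_mean k y = k * exp (- (2 * rate * y)) * integral {0..y} (\<lambda>r. cos_mean k r * exp (2 * rate * r))"
proof -
  have cont: "continuous_on {0..y} (\<lambda>r. cos_mean k r * exp (2 * rate * r))"
    by (intro continuous_intros continuous_on_subset[OF cos_mean_continuous]) auto
  have "(LBINT r:{0..y}. cos_mean k r * exp (- (2 * rate * (y - r))))
      = (LBINT r:{0..y}. exp (- (2 * rate * y)) * (cos_mean k r * exp (2 * rate * r)))"
    by (intro set_lebesgue_integral_cong) (auto simp: algebra_simps exp_add[symmetric])
  also have "\<dots> = exp (- (2 * rate * y)) * (LBINT r:{0..y}. cos_mean k r * exp (2 * rate * r))"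
    by (rule set_integral_mult_right)
  also have "(LBINT r:{0..y}. cos_mean k r * exp (2 * rate * r))
      = integral {0..y} (\<lambda>r. cos_mean k r * exp (2 * rate * r))"
    by (rule set_borel_integral_eq_integral(2)[OF borel_integrable_atLeastAtMost'[OF cont]])
  finally show ?thesis unfolding sin_mean_eq[OF y] by simp
qed

text \<open>The one-sided form includes \<open>y = 0\<close>, which is needed for continuity
  there.\<close>

lemma sin_mean_has_derivative_within:
  assumes "0 \<le> y"
  shows "(sin_mean k has_real_derivative k * cos_mean k y - 2 * rate * sin_mean k y) (at y within {0..y + 1})"
proof -
  let ?g = "\<lambda>r. cos_mean k r * exp (2 * rate * r)"
  have cont: "continuous_on {0..y + 1} ?g"
    by (intro continuous_intros continuous_on_subset[OF cos_mean_continuous]) auto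
  have "((\<lambda>y. k * exp (- (2 * rate * y)) * integral {0..y} ?g) has_real_derivative
      k * (exp (- (2 * rate * y)) * - (2 * rate)) * integral {0..y} ?g
      + ?g y * (k * exp (- (2 * rate * y)))) (at y within {0..y + 1})"
    using assms by (intro DERIV_mult integral_has_real_derivative[OF cont]) (auto intro!: derivative_eq_intros)
  also have "k * (exp (- (2 * rate * y)) * - (2 * rate)) * integral {0..y} ?g
      + ?g y * (k * exp (- (2 * rate * y))) = k * cos_mean k y - 2 * rate * sin_mean k y"
    unfolding sin_mean_eq_integral[OF assms] by (simp add: algebra_simps exp_minus)
  finally show ?thesis
    by (rule has_field_derivative_transform_within[where d=1]) (use assms in \<open>auto simp: sin_mean_eq_integral\<close>)
qed

lemma sin_mean_has_derivative:
  assumes "0 < y"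
  shows "(sin_mean k has_real_derivative k * cos_mean k y - 2 * rate * sin_mean k y) (at y)"
  using sin_mean_has_derivative_within[of y k] at_within_Icc_plus_one[OF assms] assms by simp

text \<open>The paths of \<open>flip\<close> jump, so continuity comes from the integral equation
  rather than from the paths.\<close>

lemma sin_mean_continuous: "continuous_on {0..} (sin_mean k)"
  unfolding continuous_on_eq_continuous_within
proof
  fix y :: real assume y: "y \<in> {0..}"
  then have "continuous (at y within {0..y + 1}) (sin_mean k)"
    by (intro DERIV_continuous[OF sin_mean_has_derivative_within]) auto
  moreover have "at y within {0..y + 1} = at y within {0..}"
    by (rule at_within_nhd[of _ "{..<y + 1}"]) auto
  ultimately show "continuous (at y within {0..}) (sin_mean k)"
    by simp
qed

lemma cos_mean_has_derivative:
  assumes "0 < x"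
  shows "(cos_mean k has_real_derivative - k * sin_mean k x) (at x)"
proof -
  have cont: "continuous_on {0..y} (sin_mean k)" for y
    by (rule continuous_on_subset[OF sin_mean_continuous]) auto
  have eq: "cos_mean k y = 1 - k * integral {0..y} (sin_mean k)" if "0 \<le> y" for y
    unfolding cos_mean_eq[OF that]
    by (subst set_borel_integral_eq_integral(2)[OF borel_integrable_atLeastAtMost'[OF cont]]) simp
  have "((\<lambda>y. 1 - k * integral {0..y} (sin_mean k)) has_real_derivative 0 - k * sin_mean k x) (at x within {0..x + 1})"
    using assms by (intro DERIV_diff DERIV_const DERIV_cmult integral_has_real_derivative[OF cont]) auto
  then have "(cos_mean k has_real_derivative 0 - k * sin_mean k x) (at x within {0..x + 1})"
    by (rule has_field_derivative_transform_within[where d=1]) (use assms in \<open>auto simp: eq\<close>)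
  then show ?thesis
    using at_within_Icc_plus_one[OF assms] by simp
qed

lemma cos_mean_laplace:
  assumes \<nu>: "0 < \<nu>"
  shows "(LBINT x:{0<..}. exp (- (\<nu> * x)) * cos_mean k x) = (\<nu> + 2 * rate) / (\<nu> * (\<nu> + 2 * rate) + k\<^sup>2)"
proof -
  \<comment> \<open>The determinant of the transformed system \<nu> C - 1 = - k S, (\<nu> + 2 rate)
    S = k C.\<close>
  define D where "D = \<nu> * (\<nu> + 2 * rate) + k\<^sup>2"
  have D: "0 < D"
    unfolding D_def using \<nu> rate_pos by (intro add_pos_nonneg mult_pos_pos) auto
  \<comment> \<open>\<open>F\<close> is an antiderivative because \<open>C = cos_mean k\<close> and \<open>S = sin_mean k\<close> solve
    \<open>C' = - k S\<close> and \<open>S' = k C - 2 rate S\<close>\<close>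
  define F where "F x = - (exp (- (\<nu> * x)) * (((\<nu> + 2 * rate) * cos_mean k x - k * sin_mean k x) / D))" for x
  have cont: "isCont (cos_mean k) x" if "0 < x" for x
    using DERIV_isCont[OF cos_mean_has_derivative[OF that]] .
  have int: "set_integrable lborel {0<..} (\<lambda>x. exp (- (\<nu> * x)) * cos_mean k x)"
    using abs_cos_mean_le
    by (intro exp_times_bounded_set_integrable \<nu> continuous_on_subset[OF cos_mean_continuous]) auto
  have ei: "einterval 0 \<infinity> = {0<..}"
    by (auto simp: einterval_def)
  have "(LBINT x=0..\<infinity>. exp (- (\<nu> * x)) * cos_mean k x) = 0 - (- ((\<nu> + 2 * rate) / D))"
  proof (rule interval_integral_FTC_integrable)
    fix x assume "0 < ereal x" "ereal x < \<infinity>"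
    then have x: "0 < x" by simp
    show "isCont (\<lambda>x. exp (- (\<nu> * x)) * cos_mean k x) x"
      by (intro continuous_intros cont x)
    have "(F has_real_derivative
        - (exp (- (\<nu> * x)) * (- \<nu>) * (((\<nu> + 2 * rate) * cos_mean k x - k * sin_mean k x) / D)
          + ((\<nu> + 2 * rate) * (- k * sin_mean k x) - k * (k * cos_mean k x - 2 * rate * sin_mean k x)) / D
            * exp (- (\<nu> * x)))) (at x)"
      unfolding F_def
      by (intro DERIV_minus DERIV_mult DERIV_cdivide DERIV_diff DERIV_cmult cos_mean_has_derivative
          sin_mean_has_derivative x) (auto intro!: derivative_eq_intros)
    \<comment> \<open>\<open>D / D\<close> stays uncancelled so that both sides are fractions over
      \<open>D\<close> and only numerators need comparing.\<close>
    also have "- (exp (- (\<nu> * x)) * (- \<nu>) * (((\<nu> + 2 * rate) * cos_mean k x - k * sin_mean k x) / D)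
          + ((\<nu> + 2 * rate) * (- k * sin_mean k x) - k * (k * cos_mean k x - 2 * rate * sin_mean k x)) / D
            * exp (- (\<nu> * x)))
        = exp (- (\<nu> * x)) * (cos_mean k x * (D / D))"
      unfolding times_divide_eq_right times_divide_eq_left diff_divide_distrib[symmetric] add_divide_distrib[symmetric]
        minus_divide_left
      by (rule arg_cong2[where f="(/)"]) (simp_all add: D_def algebra_simps power2_eq_square)
    finally show "(F has_vector_derivative exp (- (\<nu> * x)) * cos_mean k x) (at x)"
      using D by (simp add: has_real_derivative_iff_has_vector_derivative)
  next
    have lim: "(cos_mean k \<longlongrightarrow> 1) (at_right 0)" "(sin_mean k \<longlongrightarrow> 0) (at_right 0)"
      using cos_mean_continuous[of k] sin_mean_continuous[of k]
      by (auto simp: continuous_on_def intro: tendsto_within_subset dest!: bspec[of _ _ 0])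
    have "(F \<longlongrightarrow> - (exp (- (\<nu> * 0)) * (((\<nu> + 2 * rate) * 1 - k * 0) / D))) (at_right 0)"
      unfolding F_def using D by (intro tendsto_intros lim) auto
    then show "((F \<circ> real_of_ereal) \<longlongrightarrow> - ((\<nu> + 2 * rate) / D)) (at_right 0)"
      unfolding zero_ereal_def ereal_tendsto_simps1(2) by simp
    have "(F \<longlongrightarrow> 0) at_top"
    proof (rule Lim_null_comparison)
      show "((\<lambda>x. exp (- (\<nu> * x)) * ((\<nu> + 2 * rate + \<bar>k\<bar>) / D)) \<longlongrightarrow> 0) at_top"
        using \<nu> by real_asymp
      have "norm (F x) \<le> exp (- (\<nu> * x)) * ((\<nu> + 2 * rate + \<bar>k\<bar>) / D)" for x
      proof -
        have "\<bar>(\<nu> + 2 * rate) * cos_mean k x - k * sin_mean k x\<bar>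
            \<le> \<bar>(\<nu> + 2 * rate) * cos_mean k x\<bar> + \<bar>k * sin_mean k x\<bar>"
          by (rule abs_triangle_ineq4)
        also have "\<dots> \<le> (\<nu> + 2 * rate) + \<bar>k\<bar>"
          using abs_cos_mean_le[of k x] abs_sin_mean_le[of k x] \<nu> rate_pos
          by (intro add_mono) (auto simp: abs_mult mult_left_le)
        finally show ?thesis
          using D unfolding F_def by (auto simp: abs_mult intro!: mult_left_mono divide_right_mono)
      qed
      then show "\<forall>\<^sub>F x in at_top. norm (F x) \<le> exp (- (\<nu> * x)) * ((\<nu> + 2 * rate + \<bar>k\<bar>) / D)"
        by simp
    qed
    then show "((F \<circ> real_of_ereal) \<longlongrightarrow> 0) (at_left \<infinity>)"
      unfolding ereal_tendsto_simps1 .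
  qed (use int in \<open>auto simp: ei\<close>)
  then show ?thesis
    by (simp add: interval_lebesgue_integral_def ei D_def)
qed

end

section \<open>The random initial velocity\<close>

context telegraph_data
begin

lemma telegraph_eq: "telegraph V N t \<omega> = V \<omega> * drift t \<omega>"
  by (simp add: telegraph_def drift_def flip_def)

text \<open>Independence is inherited by smaller sigma-algebras, and \<open>drift x\<close> is
  measurable for the one generated by the paths of \<open>N\<close>.\<close>

lemma drift_indep_V:
  assumes x: "0 \<le> x"
  shows "indep_var borel (drift x) borel V"
proof -
  let ?A = "vimage_algebra (space M) (\<lambda>\<omega>. \<lambda>t\<in>{0..}. N t \<omega>) (\<Pi>\<^sub>M t\<in>{0..}. borel)"
  let ?B = "vimage_algebra (space M) V borel"
  have N: "N t \<in> borel_measurable ?A" if "0 \<le> t" for t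
  proof -
    have "(\<lambda>\<omega>. \<lambda>t\<in>{0..}. N t \<omega>) \<in> measurable ?A (\<Pi>\<^sub>M t\<in>{0..}. borel)"
      by (rule measurable_vimage_algebra1) (auto simp: space_PiM)
    from measurable_compose[OF this measurable_component_singleton[of t]] that show ?thesis by simp
  qed
  have D: "drift x \<in> borel_measurable ?A"
    by (rule drift_measurable[OF _ N x]) simp_all
  have V: "V \<in> borel_measurable ?B"
    by (rule measurable_vimage_algebra1) simp
  have sub: "sigma_sets (space M) {Y -` S \<inter> space M |S. S \<in> sets borel} \<subseteq> sets C"
    if "Y \<in> borel_measurable C" "space C = space M" for Y :: "'a \<Rightarrow> real" and C
  proof -
    have "sigma_sets (space C) {Y -` S \<inter> space C |S. S \<in> sets borel} \<subseteq> sets C"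
      using that(1) by (intro sets.sigma_sets_subset) (auto simp: measurable_sets)
    then show ?thesis using that(2) by simp
  qed
  have sub_D: "sigma_sets (space M) {drift x -` S \<inter> space M |S. S \<in> sets borel} \<subseteq> sets ?A"
    by (rule sub[OF D]) simp
  have sub_V: "sigma_sets (space M) {V -` S \<inter> space M |S. S \<in> sets borel} \<subseteq> sets ?B"
    by (rule sub[OF V]) simp
  have "indep_set (sigma_sets (space M) {drift x -` S \<inter> space M |S. S \<in> sets borel})
      (sigma_sets (space M) {V -` S \<inter> space M |S. S \<in> sets borel})"
    unfolding indep_set_def
    by (rule indep_sets_mono_sets[OF N_indep_V[unfolded indep_set_def]])
      (auto split: bool.split dest!: subsetD[OF sub_D] subsetD[OF sub_V])
  then show ?thesis
    unfolding indep_var_eq using drift_measurable[OF refl measurable_N x] measurable_V by simp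
qed

lemma telegraph_measurable:
  assumes "0 \<le> x"
  shows "telegraph V N x \<in> borel_measurable M"
  unfolding telegraph_eq[abs_def] using drift_measurable[OF refl measurable_N assms] measurable_V by measurable

lemma telegraph_continuous:
  assumes "\<omega> \<in> space M"
  shows "continuous_on {0..} (\<lambda>t. telegraph V N t \<omega>)"
  unfolding telegraph_eq by (intro continuous_intros drift_continuous assms)

text \<open>Averaging over the two equally likely velocities, independent of the drift, pairs
  conjugate exponentials into a cosine.\<close>

lemma telegraph_char:
  assumes x: "0 \<le> x"
  shows "expectation (\<lambda>\<omega>. iexp (\<xi> * telegraph V N x \<omega>)) = complex_of_real (cos_mean (\<xi> * c) x)"
proof -
  note [measurable] = drift_measurable[OF refl measurable_N x] measurable_V
  have half: "expectation (\<lambda>\<omega>. iexp (\<xi> * v * drift x \<omega>) * complex_of_real (indicator {v} (V \<omega>)))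
      = expectation (\<lambda>\<omega>. iexp (\<xi> * v * drift x \<omega>)) / 2"
    and int: "integrable M (\<lambda>\<omega>. iexp (\<xi> * v * drift x \<omega>) * complex_of_real (indicator {v} (V \<omega>)))"
    if v: "prob {\<omega> \<in> space M. V \<omega> = v} = 1 / 2" for v
  proof -
    have ind: "indep_var borel (\<lambda>\<omega>. iexp (\<xi> * v * drift x \<omega>)) borel (\<lambda>\<omega>. complex_of_real (indicator {v} (V \<omega>)))"
      using indep_var_compose[OF drift_indep_V[OF x], of "\<lambda>d. iexp (\<xi> * v * d)" borel
          "\<lambda>r. complex_of_real (indicator {v} r)" borel]
      by (simp add: comp_def)
    have i1: "integrable M (\<lambda>\<omega>. iexp (\<xi> * v * drift x \<omega>))"
      by (intro integrable_const_bound[where B=1]) auto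
    have i2: "integrable M (\<lambda>\<omega>. complex_of_real (indicator {v} (V \<omega>)))"
      by (intro integrable_const_bound[where B=1]) (auto split: split_indicator)
    have "expectation (\<lambda>\<omega>. indicat_real {v} (V \<omega>)) = expectation (indicator {\<omega> \<in> space M. V \<omega> = v})"
      by (intro Bochner_Integration.integral_cong) (auto split: split_indicator)
    also have "\<dots> = 1 / 2"
      using v by simp
    finally have "expectation (\<lambda>\<omega>. complex_of_real (indicator {v} (V \<omega>))) = complex_of_real (1 / 2)"
      by (simp only: integral_complex_of_real)
    then show "expectation (\<lambda>\<omega>. iexp (\<xi> * v * drift x \<omega>) * complex_of_real (indicator {v} (V \<omega>)))
        = expectation (\<lambda>\<omega>. iexp (\<xi> * v * drift x \<omega>)) / 2"
      unfolding indep_var_lebesgue_integral[OF ind i1 i2] by simp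
    show "integrable M (\<lambda>\<omega>. iexp (\<xi> * v * drift x \<omega>) * complex_of_real (indicator {v} (V \<omega>)))"
      by (rule indep_var_integrable[OF ind i1 i2])
  qed
  \<comment> \<open>The events are disjoint because \<open>c > 0\<close>, so their probabilities add
    up to 1 and \<open>V\<close> has almost surely no other value.\<close>
  have "AE \<omega> in M. \<omega> \<in> {\<omega> \<in> space M. V \<omega> = c} \<union> {\<omega> \<in> space M. V \<omega> = - c}"
  proof (rule AE_prob_1)
    show "prob ({\<omega> \<in> space M. V \<omega> = c} \<union> {\<omega> \<in> space M. V \<omega> = - c}) = 1"
      using c_pos V_plus V_minus by (subst finite_measure_Union) auto
  qed
  then have "AE \<omega> in M. iexp (\<xi> * telegraph V N x \<omega>)
      = iexp (\<xi> * c * drift x \<omega>) * complex_of_real (indicator {c} (V \<omega>))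
      + iexp (\<xi> * (- c) * drift x \<omega>) * complex_of_real (indicator {- c} (V \<omega>))"
    by eventually_elim (use c_pos in \<open>auto simp: telegraph_eq mult.assoc\<close>)
  then have "expectation (\<lambda>\<omega>. iexp (\<xi> * telegraph V N x \<omega>))
      = expectation (\<lambda>\<omega>. iexp (\<xi> * c * drift x \<omega>) * complex_of_real (indicator {c} (V \<omega>))
      + iexp (\<xi> * (- c) * drift x \<omega>) * complex_of_real (indicator {- c} (V \<omega>)))"
    using telegraph_measurable[OF x]
    by (intro integral_cong_AE borel_measurable_add borel_measurable_integrable[OF int[OF V_plus]]
        borel_measurable_integrable[OF int[OF V_minus]]) measurable
  also have "\<dots> = expectation (\<lambda>\<omega>. iexp (\<xi> * c * drift x \<omega>)) / 2 + expectation (\<lambda>\<omega>. iexp (\<xi> * (- c) * drift x \<omega>)) / 2"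
    unfolding Bochner_Integration.integral_add[OF int[OF V_plus] int[OF V_minus]] half[OF V_plus] half[OF V_minus] ..
  also have "\<dots> = expectation (\<lambda>\<omega>. iexp (\<xi> * c * drift x \<omega>) / 2 + iexp (\<xi> * (- c) * drift x \<omega>) / 2)"
    by (subst Bochner_Integration.integral_add)
      (auto intro!: integrable_const_bound[where B=1] integral_divide_zero[symmetric])
  also have "\<dots> = expectation (\<lambda>\<omega>. complex_of_real (cos (\<xi> * c * drift x \<omega>)))"
    by (intro Bochner_Integration.integral_cong refl)
      (simp add: complex_eq_iff Re_exp Im_exp)
  also have "\<dots> = complex_of_real (cos_mean (\<xi> * c) x)"
    by (simp add: cos_mean_def)
  finally show ?thesis .
qed

end

subsection \<open>The inverse of the drifted subordinator\<close>

context half_stable_subordinator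
begin

context
  fixes lam :: real
  assumes lam: "0 < lam"
begin

abbreviation "X \<equiv> drifted_subordinator lam H"
abbreviation "L \<equiv> inverse_process (drifted_subordinator lam H)"

text \<open>The drift term makes \<open>X\<close> grow at rate at least 1. This gives a well-defined
  inverse and bounds its slope by 1.\<close>

lemma drifted_subordinator_increment:
  assumes \<omega>: "\<omega> \<in> space M" and "0 \<le> s" "s \<le> u"
  shows "X s \<omega> + (u - s) \<le> X u \<omega>"
proof -
  have "H s \<omega> \<le> H u \<omega>"
    using H_mono[OF \<omega>] assms(2,3) by (auto simp: mono_on_def)
  then have "(2 * lam)\<^sup>2 * H s \<omega> \<le> (2 * lam)\<^sup>2 * H u \<omega>"
    by (rule mult_left_mono) simp
  then show ?thesis by (simp add: drifted_subordinator_def)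
qed

lemma drifted_subordinator_ge:
  assumes "\<omega> \<in> space M" "0 \<le> s"
  shows "s \<le> X s \<omega>"
  using drifted_subordinator_increment[OF assms(1) order_refl assms(2)] H_0[OF assms(1)]
  by (simp add: drifted_subordinator_def)

lemma drifted_subordinator_right_continuous:
  assumes "\<omega> \<in> space M" "0 \<le> s"
  shows "continuous (at_right s) (\<lambda>s. X s \<omega>)"
  unfolding drifted_subordinator_def by (intro continuous_intros H_right_continuous assms)

lemma drifted_subordinator_measurable:
  assumes "f \<in> borel_measurable A" "g \<in> measurable A M" "\<And>x. x \<in> space A \<Longrightarrow> 0 \<le> f x"
  shows "(\<lambda>x. X (f x) (g x)) \<in> borel_measurable A"
proof (rule right_continuous_process_measurable[OF _ drifted_subordinator_right_continuous assms])
  show "X t \<in> borel_measurable M" if "0 \<le> t" for t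
    unfolding drifted_subordinator_def using measurable_H[OF that] by measurable
qed auto

lemma inverse_process_set:
  assumes "\<omega> \<in> space M"
  shows "{s. s > 0 \<and> X s \<omega> \<ge> t} \<noteq> {}" "bdd_below {s. s > 0 \<and> X s \<omega> \<ge> t}"
proof -
  have "max 1 t \<le> X (max 1 t) \<omega>" by (rule drifted_subordinator_ge[OF assms]) simp
  then have "max 1 t \<in> {s. s > 0 \<and> X s \<omega> \<ge> t}" by simp
  then show "{s. s > 0 \<and> X s \<omega> \<ge> t} \<noteq> {}" by blast
  show "bdd_below {s. s > 0 \<and> X s \<omega> \<ge> t}" by (rule bdd_belowI[of _ 0]) auto
qed

lemma inverse_process_nonneg:
  assumes "\<omega> \<in> space M"
  shows "0 \<le> L t \<omega>"
  unfolding inverse_process_def by (rule cInf_greatest[OF inverse_process_set(1)[OF assms]]) auto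

text \<open>Right-continuity keeps \<open>X\<close> below \<open>t\<close> slightly beyond
  \<open>s\<close>, which pushes the infimum strictly above \<open>s\<close>. The equivalence trades
  the inverse process for the subordinator, whose Laplace transform is known.\<close>

lemma less_inverse_process_iff:
  assumes \<omega>: "\<omega> \<in> space M" and t: "0 < t" and s: "0 \<le> s"
  shows "s < L t \<omega> \<longleftrightarrow> X s \<omega> < t"
proof
  assume lt: "s < L t \<omega>"
  show "X s \<omega> < t"
  proof (rule ccontr)
    assume "\<not> X s \<omega> < t"
    \<comment> \<open>The infimum runs over positive times only; \<open>s = 0\<close> is excluded
      since \<open>X\<close> starts at 0 and \<open>t > 0\<close>.\<close>
    moreover from this have "s \<noteq> 0"
      using H_0[OF \<omega>] t by (auto simp: drifted_subordinator_def)
    ultimately have "s \<in> {s. s > 0 \<and> X s \<omega> \<ge> t}" using s by auto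
    then have "L t \<omega> \<le> s"
      unfolding inverse_process_def by (rule cInf_lower[OF _ inverse_process_set(2)[OF \<omega>]])
    with lt show False by simp
  qed
next
  assume lt: "X s \<omega> < t"
  have "\<forall>\<^sub>F u in at_right s. X u \<omega> < t"
    using drifted_subordinator_right_continuous[OF \<omega> s] lt
    unfolding continuous_within by (rule order_tendstoD)
  then obtain b where b: "s < b" "\<And>u. s < u \<Longrightarrow> u < b \<Longrightarrow> X u \<omega> < t"
    unfolding eventually_at_right_field by auto
  have "b \<le> L t \<omega>"
    unfolding inverse_process_def
  proof (rule cInf_greatest[OF inverse_process_set(1)[OF \<omega>]])
    fix a assume "a \<in> {s. s > 0 \<and> X s \<omega> \<ge> t}"
    then have a: "0 < a" "t \<le> X a \<omega>" by auto
    show "b \<le> a"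
    proof (rule ccontr)
      assume "\<not> b \<le> a"
      then have "a \<le> s" using b(2)[of a] a(2) by force
      then have "X a \<omega> \<le> X s \<omega>"
        using drifted_subordinator_increment[OF \<omega>, of a s] a(1) by simp
      with a(2) lt show False by simp
    qed
  qed
  with b(1) show "s < L t \<omega>" by simp
qed

text \<open>A function growing at rate at least 1 has an inverse growing at rate at most 1; jumps of
  \<open>H\<close> only create flat stretches.\<close>

lemma inverse_process_lipschitz:
  assumes \<omega>: "\<omega> \<in> space M" and t: "0 < t" "t \<le> u"
  shows "\<bar>L u \<omega> - L t \<omega>\<bar> \<le> u - t"
proof -
  note nonneg = inverse_process_nonneg[OF \<omega>]
  have "L t \<omega> \<le> L u \<omega>"
    unfolding inverse_process_def
    by (rule cInf_superset_mono[OF inverse_process_set(1)[OF \<omega>] inverse_process_set(2)[OF \<omega>]]) (use t in auto)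
  moreover have "L u \<omega> \<le> L t \<omega> + (u - t)"
  proof -
    have "t \<le> X (L t \<omega>) \<omega>"
      using less_inverse_process_iff[OF \<omega> t(1) nonneg[of t]] by simp
    also have "X (L t \<omega>) \<omega> + (u - t) \<le> X (L t \<omega> + (u - t)) \<omega>"
      using drifted_subordinator_increment[OF \<omega> nonneg[of t], of "L t \<omega> + (u - t)"] t by simp
    finally have "u \<le> X (L t \<omega> + (u - t)) \<omega>" by simp
    then show ?thesis
      using less_inverse_process_iff[OF \<omega>, of u "L t \<omega> + (u - t)"] t nonneg[of t] by simp
  qed
  ultimately show ?thesis by simp
qed

lemma inverse_process_continuous:
  assumes \<omega>: "\<omega> \<in> space M"
  shows "continuous_on {0<..} (\<lambda>t. L t \<omega>)"
proof (rule continuous_onI)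
  fix t \<epsilon> :: real assume t: "t \<in> {0<..}" and \<epsilon>: "0 < \<epsilon>"
  have "\<bar>L u \<omega> - L t \<omega>\<bar> \<le> \<bar>u - t\<bar>" if "0 < u" for u
    using inverse_process_lipschitz[OF \<omega>, of t u] inverse_process_lipschitz[OF \<omega>, of u t] t that
    by (cases "t \<le> u") (simp_all add: abs_minus_commute)
  then show "\<exists>d>0. \<forall>u\<in>{0<..}. dist u t < d \<longrightarrow> dist (L u \<omega>) (L t \<omega>) \<le> \<epsilon>"
    using \<epsilon> by (intro exI[of _ \<epsilon>]) (fastforce simp: dist_real_def)
qed

lemma inverse_process_measurable:
  assumes t: "0 < t"
  shows "L t \<in> borel_measurable M"
  unfolding borel_measurable_iff_greater
proof
  fix a
  show "{\<omega> \<in> space M. a < L t \<omega>} \<in> events"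
  proof (cases "0 \<le> a")
    case True
    have "X a \<in> borel_measurable M"
      unfolding drifted_subordinator_def using measurable_H[OF True] by measurable
    then have "{\<omega> \<in> space M. X a \<omega> < t} \<in> events" by measurable
    also have "{\<omega> \<in> space M. X a \<omega> < t} = {\<omega> \<in> space M. a < L t \<omega>}"
      using less_inverse_process_iff[OF _ t True] by auto
    finally show ?thesis .
  next
    case False
    then have "{\<omega> \<in> space M. a < L t \<omega>} = space M"
      by (auto intro: less_le_trans[OF _ inverse_process_nonneg])
    then show ?thesis by simp
  qed
qed

lemma drifted_subordinator_laplace:
  assumes "0 \<le> s" "0 < \<mu>"
  shows "expectation (\<lambda>\<omega>. exp (- (\<mu> * X s \<omega>))) = exp (- ((\<mu> + 2 * lam * sqrt \<mu>) * s))"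
\<comment> \<open>\<open>H_laplace\<close> covers only increments over intervals of positive
  length.\<close>
proof (cases "s = 0")
  case True
  then have "expectation (\<lambda>\<omega>. exp (- (\<mu> * X s \<omega>))) = expectation (\<lambda>\<omega>. 1)"
    by (intro Bochner_Integration.integral_cong) (auto simp: drifted_subordinator_def H_0)
  then show ?thesis using True by (simp add: prob_space)
next
  case False
  have "expectation (\<lambda>\<omega>. exp (- (\<mu> * X s \<omega>)))
      = expectation (\<lambda>\<omega>. exp (- (\<mu> * s)) * exp (- (\<mu> * (2 * lam)\<^sup>2) * (H s \<omega> - H 0 \<omega>)))"
    by (intro Bochner_Integration.integral_cong)
      (auto simp: drifted_subordinator_def H_0 exp_add[symmetric] algebra_simps)
  also have "\<dots> = exp (- (\<mu> * s)) * exp (- (s - 0) * sqrt (\<mu> * (2 * lam)\<^sup>2))"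
    using False assms lam H_laplace[of 0 s "\<mu> * (2 * lam)\<^sup>2"] by simp
  also have "sqrt (\<mu> * (2 * lam)\<^sup>2) = sqrt \<mu> * (2 * lam)"
    using lam by (simp add: real_sqrt_mult)
  finally show ?thesis by (simp add: exp_add[symmetric] algebra_simps)
qed

lemma exp_inverse_process_bounds:
  assumes "\<omega> \<in> space M" "0 \<le> \<theta>"
  shows "0 < exp (- (\<theta> * L t \<omega>))" "exp (- (\<theta> * L t \<omega>)) \<le> 1"
  using inverse_process_nonneg[OF assms(1), of t] assms(2) by auto

text \<open>Working with 1 - exp(-\<theta> L), the integral of a density over s < L, keeps every
  integrand nonnegative, so integrals may be exchanged without integrability conditions.\<close>

lemma inverse_process_nn_laplace:
  assumes \<theta>: "0 \<le> \<theta>" and \<mu>: "0 < \<mu>"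
  defines "q \<equiv> \<mu> + 2 * lam * sqrt \<mu>"
  shows "(\<integral>\<^sup>+t. ennreal (\<mu> * exp (- (\<mu> * t))) * indicator {0<..} t
      * ennreal (expectation (\<lambda>\<omega>. 1 - exp (- (\<theta> * L t \<omega>)))) \<partial>lborel) = ennreal (\<theta> / (\<theta> + q))"
proof -
  interpret LM: pair_sigma_finite lborel M ..
  have q: "0 < q" using \<mu> lam by (simp add: q_def add_pos_nonneg)
  define e where "e t = ennreal (\<mu> * exp (- (\<mu> * t)))" for t
  define d where "d s = ennreal (\<theta> * exp (- (\<theta> * s)))" for s
  define f where "f t \<omega> s = e t * indicator {0<..} t * (d s * indicator {0..} s * (if X (max 0 s) \<omega> < t then 1 else 0))"
    for t \<omega> s
  have [measurable]: "e \<in> borel_measurable borel" "d \<in> borel_measurable borel"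
    unfolding e_def d_def by measurable
  have X_meas [measurable (raw)]: "(\<lambda>x. X (max 0 (h x)) (g x)) \<in> borel_measurable A"
    if "h \<in> borel_measurable A" "g \<in> measurable A M" for A h g
    using that by (intro drifted_subordinator_measurable) auto
  have s_int: "(\<integral>\<^sup>+s. f t \<omega> s \<partial>lborel) = e t * indicator {0<..} t * ennreal (1 - exp (- (\<theta> * L t \<omega>)))"
    if \<omega>: "\<omega> \<in> space M" for t \<omega>
  proof (cases "0 < t")
    case True
    have "(\<integral>\<^sup>+s. f t \<omega> s \<partial>lborel)
        = e t * indicator {0<..} t * (\<integral>\<^sup>+s. d s * indicator {0..} s * (if X (max 0 s) \<omega> < t then 1 else 0) \<partial>lborel)"
      unfolding f_def using \<omega> by (intro nn_integral_cmult) measurable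
    also have "(\<integral>\<^sup>+s. d s * indicator {0..} s * (if X (max 0 s) \<omega> < t then 1 else 0) \<partial>lborel)
        = (\<integral>\<^sup>+s. d s * indicator {0..<L t \<omega>} s \<partial>lborel)"
      by (intro nn_integral_cong) (auto simp: less_inverse_process_iff[OF \<omega> True] split: split_indicator)
    also have "\<dots> = ennreal (1 - exp (- (\<theta> * L t \<omega>)))"
      unfolding d_def by (rule nn_integral_exp_atLeastLessThan[OF \<theta> inverse_process_nonneg[OF \<omega>]])
    finally show ?thesis .
  qed (simp add: f_def)
  \<comment> \<open>the order of integration that does not see \<open>L\<close>\<close>
  have t_int: "(\<integral>\<^sup>+t. f t \<omega> s \<partial>lborel) = d s * indicator {0..} s * ennreal (exp (- (\<mu> * X s \<omega>)))"
    if \<omega>: "\<omega> \<in> space M" for s \<omega>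
  proof (cases "0 \<le> s")
    case True
    have "0 \<le> X s \<omega>" using drifted_subordinator_ge[OF \<omega> True] True by simp
    then have "(\<integral>\<^sup>+t. f t \<omega> s \<partial>lborel) = (\<integral>\<^sup>+t. d s * (e t * indicator {X s \<omega><..} t) \<partial>lborel)"
      using True unfolding f_def by (intro nn_integral_cong) (auto simp: mult.commute split: split_indicator)
    also have "\<dots> = d s * (\<integral>\<^sup>+t. e t * indicator {X s \<omega><..} t \<partial>lborel)"
      by (intro nn_integral_cmult) measurable
    also have "(\<integral>\<^sup>+t. e t * indicator {X s \<omega><..} t \<partial>lborel) = ennreal (exp (- (\<mu> * X s \<omega>)))"
      unfolding e_def using nn_integral_exp_greaterThan[of \<mu> \<mu> "X s \<omega>"] \<mu> by simp
    finally show ?thesis using True by simp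
  qed (simp add: f_def)
  have "(\<integral>\<^sup>+t. e t * indicator {0<..} t * ennreal (expectation (\<lambda>\<omega>. 1 - exp (- (\<theta> * L t \<omega>)))) \<partial>lborel)
      = (\<integral>\<^sup>+t. \<integral>\<^sup>+\<omega>. \<integral>\<^sup>+s. f t \<omega> s \<partial>lborel \<partial>M \<partial>lborel)"
  proof (rule nn_integral_cong)
    fix t :: real
    show "e t * indicator {0<..} t * ennreal (expectation (\<lambda>\<omega>. 1 - exp (- (\<theta> * L t \<omega>))))
        = (\<integral>\<^sup>+\<omega>. \<integral>\<^sup>+s. f t \<omega> s \<partial>lborel \<partial>M)"
    proof (cases "0 < t")
      case True
      note [measurable] = inverse_process_measurable[OF True]
      have "ennreal (expectation (\<lambda>\<omega>. 1 - exp (- (\<theta> * L t \<omega>))))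
          = (\<integral>\<^sup>+\<omega>. ennreal (1 - exp (- (\<theta> * L t \<omega>))) \<partial>M)"
        using exp_inverse_process_bounds(2)[OF _ \<theta>]
        by (intro nn_integral_eq_integral[symmetric] integrable_const_bound[where B=1] AE_I2) auto
      then have "e t * indicator {0<..} t * ennreal (expectation (\<lambda>\<omega>. 1 - exp (- (\<theta> * L t \<omega>))))
          = (\<integral>\<^sup>+\<omega>. e t * indicator {0<..} t * ennreal (1 - exp (- (\<theta> * L t \<omega>))) \<partial>M)"
        by (simp add: nn_integral_cmult)
      also have "\<dots> = (\<integral>\<^sup>+\<omega>. \<integral>\<^sup>+s. f t \<omega> s \<partial>lborel \<partial>M)"
        by (intro nn_integral_cong s_int[symmetric])
      finally show ?thesis .
    qed (simp add: f_def)
  qed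
  \<comment> \<open>Three exchanges of neighbouring integrals make the integral over
    \<open>t\<close> the innermost one.\<close>
  also have "\<dots> = (\<integral>\<^sup>+t. \<integral>\<^sup>+s. \<integral>\<^sup>+\<omega>. f t \<omega> s \<partial>M \<partial>lborel \<partial>lborel)"
    unfolding f_def by (intro nn_integral_cong LM.Fubini') measurable
  also have "\<dots> = (\<integral>\<^sup>+s. \<integral>\<^sup>+t. \<integral>\<^sup>+\<omega>. f t \<omega> s \<partial>M \<partial>lborel \<partial>lborel)"
    unfolding f_def by (rule lborel_pair.Fubini') measurable
  also have "\<dots> = (\<integral>\<^sup>+s. \<integral>\<^sup>+\<omega>. \<integral>\<^sup>+t. f t \<omega> s \<partial>lborel \<partial>M \<partial>lborel)"
    unfolding f_def by (intro nn_integral_cong LM.Fubini'[symmetric]) measurable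
  also have "\<dots> = (\<integral>\<^sup>+s. ennreal (\<theta> * exp (- ((\<theta> + q) * s))) * indicator {0..} s \<partial>lborel)"
  proof (rule nn_integral_cong)
    fix s :: real
    have "(\<integral>\<^sup>+\<omega>. \<integral>\<^sup>+t. f t \<omega> s \<partial>lborel \<partial>M)
        = (\<integral>\<^sup>+\<omega>. d s * indicator {0..} s * ennreal (exp (- (\<mu> * X s \<omega>))) \<partial>M)"
      by (intro nn_integral_cong t_int)
    also have "\<dots> = ennreal (\<theta> * exp (- ((\<theta> + q) * s))) * indicator {0..} s"
    proof (cases "0 \<le> s")
      case True
      have [measurable]: "X s \<in> borel_measurable M"
        unfolding drifted_subordinator_def using measurable_H[OF True] by measurable
      have "(\<integral>\<^sup>+\<omega>. ennreal (exp (- (\<mu> * X s \<omega>))) \<partial>M) = ennreal (expectation (\<lambda>\<omega>. exp (- (\<mu> * X s \<omega>))))"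
        using order_trans[OF True drifted_subordinator_ge[OF _ True]] \<mu>
        by (intro nn_integral_eq_integral integrable_const_bound[where B=1] AE_I2) auto
      also have "\<dots> = ennreal (exp (- (q * s)))"
        unfolding drifted_subordinator_laplace[OF True \<mu>] q_def ..
      finally have "(\<integral>\<^sup>+\<omega>. d s * indicator {0..} s * ennreal (exp (- (\<mu> * X s \<omega>))) \<partial>M)
          = d s * indicator {0..} s * ennreal (exp (- (q * s)))"
        by (simp add: nn_integral_cmult)
      also have "\<dots> = ennreal (\<theta> * exp (- (\<theta> * s)) * exp (- (q * s))) * indicator {0..} s"
        unfolding d_def using True \<theta> by (simp add: ennreal_mult)
      finally show ?thesis by (simp add: exp_add[symmetric] algebra_simps)
    qed simp
    finally show "(\<integral>\<^sup>+\<omega>. \<integral>\<^sup>+t. f t \<omega> s \<partial>lborel \<partial>M) = ennreal (\<theta> * exp (- ((\<theta> + q) * s))) * indicator {0..} s" .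
  qed
  also have "\<dots> = (\<integral>\<^sup>+s. ennreal (\<theta> * exp (- ((\<theta> + q) * s))) * indicator {0<..} s \<partial>lborel)"
    by (rule nn_integral_cong_AE)
      (use AE_lborel_singleton[of 0] in \<open>auto elim!: eventually_mono split: split_indicator\<close>)
  also have "\<dots> = ennreal (\<theta> / (\<theta> + q))"
    using nn_integral_exp_greaterThan[of \<theta> "\<theta> + q" 0] \<theta> q by simp
  finally show ?thesis unfolding e_def .
qed

lemma inverse_process_expectation_continuous:
  assumes \<theta>: "0 \<le> \<theta>"
  shows "continuous_on {0<..} (\<lambda>t. expectation (\<lambda>\<omega>. exp (- (\<theta> * L t \<omega>))))"
proof -
  \<comment> \<open>The truncation bounds the test function on the whole line; it changes nothing
    because \<open>L\<close> is nonnegative.\<close>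
  have "continuous_on {0<..} (\<lambda>t. expectation (\<lambda>\<omega>. exp (- (\<theta> * max 0 (L t \<omega>)))))"
    using inverse_process_continuous inverse_process_measurable \<theta>
    by (intro continuous_on_expectation[where \<psi>="\<lambda>l. exp (- (\<theta> * max 0 l))" and K=1])
      (auto intro!: continuous_intros)
  also have "(\<lambda>t. expectation (\<lambda>\<omega>. exp (- (\<theta> * max 0 (L t \<omega>))))) = (\<lambda>t. expectation (\<lambda>\<omega>. exp (- (\<theta> * L t \<omega>))))"
    by (intro ext Bochner_Integration.integral_cong refl) (simp add: inverse_process_nonneg max_absorb2)
  finally show ?thesis .
qed

lemma inverse_process_laplace:
  assumes \<theta>: "0 \<le> \<theta>" and \<nu>: "0 < \<nu>"
  shows "(LBINT t:{0<..}. exp (- (\<nu>\<^sup>2 * t)) * expectation (\<lambda>\<omega>. exp (- (\<theta> * L t \<omega>))))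
      = (\<nu> + 2 * lam) / (\<nu> * (\<nu> * (\<nu> + 2 * lam) + \<theta>))"
proof -
  define a where "a t = expectation (\<lambda>\<omega>. exp (- (\<theta> * L t \<omega>)))" for t
  have \<mu>: "0 < \<nu>\<^sup>2" using \<nu> by simp
  define q where "q = \<nu>\<^sup>2 + 2 * lam * sqrt (\<nu>\<^sup>2)"
  have q_eq: "q = \<nu> * (\<nu> + 2 * lam)" using \<nu> by (simp add: q_def power2_eq_square algebra_simps)
  have q: "0 < q" unfolding q_eq using \<nu> lam by simp
  have int: "integrable M (\<lambda>\<omega>. exp (- (\<theta> * L t \<omega>)))" if "0 < t" for t
    using inverse_process_measurable[OF that] exp_inverse_process_bounds(2)[OF _ \<theta>]
    by (intro integrable_const_bound[where B=1] AE_I2) auto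
  have a: "expectation (\<lambda>\<omega>. 1 - exp (- (\<theta> * L t \<omega>))) = 1 - a t" if "0 < t" for t
    unfolding a_def using int[OF that] by (simp add: prob_space)
  have a_bounds: "0 \<le> a t" "a t \<le> 1" if "0 < t" for t
  proof -
    show "0 \<le> a t" unfolding a_def by (intro integral_nonneg_AE) simp
    show "a t \<le> 1" unfolding a_def
      using exp_inverse_process_bounds(2)[OF _ \<theta>] by (intro integral_le_const int that AE_I2)
  qed
  have [measurable]: "(\<lambda>t. indicator {0<..} t *\<^sub>R a t) \<in> borel_measurable borel"
    unfolding a_def by (rule borel_measurable_continuous_on_indicator[OF _ inverse_process_expectation_continuous[OF \<theta>]]) simp
  \<comment> \<open>\<open>a\<close> is controlled at positive times only, hence the indicator
    attached to it. The wanted integrand is recovered as the exponential density, of total mass 1,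
    minus \<open>g\<close>, divided by \<nu>^2.\<close>
  define g where "g t = \<nu>\<^sup>2 * exp (- (\<nu>\<^sup>2 * t)) * (indicator {0<..} t - indicator {0<..} t *\<^sub>R a t)" for t
  have g_nonneg: "0 \<le> g t" for t
    unfolding g_def using a_bounds by (auto split: split_indicator)
  have g_meas: "g \<in> borel_measurable borel" unfolding g_def by measurable
  have "(\<integral>\<^sup>+t. ennreal (g t) \<partial>lborel) = (\<integral>\<^sup>+t. ennreal (\<nu>\<^sup>2 * exp (- (\<nu>\<^sup>2 * t))) * indicator {0<..} t
      * ennreal (expectation (\<lambda>\<omega>. 1 - exp (- (\<theta> * L t \<omega>)))) \<partial>lborel)"
    unfolding g_def using a a_bounds
    by (intro nn_integral_cong) (auto simp: ennreal_mult split: split_indicator)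
  also have "\<dots> = ennreal (\<theta> / (\<theta> + q))"
    unfolding q_def by (rule inverse_process_nn_laplace[OF \<theta> \<mu>])
  finally have "has_bochner_integral lborel g (\<theta> / (\<theta> + q))"
    using \<theta> q g_nonneg g_meas by (intro has_bochner_integral_nn_integral) auto
  moreover have "has_bochner_integral lborel (\<lambda>t. \<nu>\<^sup>2 * exp (- (\<nu>\<^sup>2 * t)) * indicator {0<..} t) 1"
    using \<mu> nn_integral_exp_greaterThan[of "\<nu>\<^sup>2" "\<nu>\<^sup>2" 0]
    by (intro has_bochner_integral_nn_integral) (auto simp: ennreal_mult' ennreal_indicator[symmetric] simp del: ennreal_indicator)
  ultimately have "has_bochner_integral lborel
      (\<lambda>t. (\<nu>\<^sup>2 * exp (- (\<nu>\<^sup>2 * t)) * indicator {0<..} t - g t) / \<nu>\<^sup>2) ((1 - \<theta> / (\<theta> + q)) / \<nu>\<^sup>2)"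
    by (intro has_bochner_integral_divide_zero has_bochner_integral_diff)
  also have "(\<lambda>t. (\<nu>\<^sup>2 * exp (- (\<nu>\<^sup>2 * t)) * indicator {0<..} t - g t) / \<nu>\<^sup>2)
      = (\<lambda>t. indicator {0<..} t *\<^sub>R (exp (- (\<nu>\<^sup>2 * t)) * a t))"
    using \<nu> by (auto simp: g_def fun_eq_iff algebra_simps split: split_indicator)
  also have "(1 - \<theta> / (\<theta> + q)) / \<nu>\<^sup>2 = (\<nu> + 2 * lam) / (\<nu> * (\<nu> * (\<nu> + 2 * lam) + \<theta>))"
  proof -
    have "1 - \<theta> / (\<theta> + q) = q / (\<theta> + q)"
      using \<theta> q by (simp add: field_simps)
    then show ?thesis
      unfolding q_eq using \<nu> by (simp add: power2_eq_square add.commute)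
  qed
  finally have *: "has_bochner_integral lborel (\<lambda>t. indicator {0<..} t *\<^sub>R (exp (- (\<nu>\<^sup>2 * t)) * a t))
      ((\<nu> + 2 * lam) / (\<nu> * (\<nu> * (\<nu> + 2 * lam) + \<theta>)))" .
  show ?thesis
    unfolding set_lebesgue_integral_def a_def[symmetric] using * by (rule has_bochner_integral_integral_eq)
qed

end

end

subsection \<open>Brownian motion\<close>

context brownian_motion
begin

lemma B_distributed:
  assumes "0 < t"
  shows "distributed M lborel (B t) (normal_density 0 (sqrt (2 * t)))"
proof -
  have "distributed M lborel (\<lambda>\<omega>. B t \<omega> - B 0 \<omega>) (normal_density 0 (sqrt (2 * t)))"
    using B_normal[of 0 t] assms by simp
  moreover have "distr M lborel (\<lambda>\<omega>. B t \<omega> - B 0 \<omega>) = distr M lborel (B t)"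
    by (rule distr_cong) (auto simp: B_0)
  ultimately show ?thesis
    using measurable_B[of t] assms unfolding distributed_def by simp
qed

lemma B_char:
  assumes s: "0 \<le> s"
  shows "expectation (\<lambda>\<omega>. iexp (\<xi> * B s \<omega>)) = complex_of_real (exp (- (s * \<xi>\<^sup>2)))"
proof (cases "s = 0")
  case True
  have "expectation (\<lambda>\<omega>. iexp (\<xi> * B s \<omega>)) = expectation (\<lambda>\<omega>. 1 :: complex)"
    using True B_0 by (intro Bochner_Integration.integral_cong) auto
  then show ?thesis using True by (simp add: prob_space)
next
  case False
  define \<sigma> where "\<sigma> = sqrt (2 * s)"
  have \<sigma>: "0 < \<sigma>" using s False by (simp add: \<sigma>_def)
  have D: "distributed M lborel (\<lambda>\<omega>. (B s \<omega> - 0) / \<sigma>) std_normal_density"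
    using B_distributed[of s] normal_standard_normal_convert[OF \<sigma>, of "B s" 0] s False by (simp add: \<sigma>_def)
  have "expectation (\<lambda>\<omega>. iexp (\<xi> * B s \<omega>)) = expectation (\<lambda>\<omega>. iexp (\<xi> * \<sigma> * ((B s \<omega> - 0) / \<sigma>)))"
    using \<sigma> by simp
  also have "\<dots> = (\<integral>z. iexp (\<xi> * \<sigma> * z) \<partial>distr M lborel (\<lambda>\<omega>. (B s \<omega> - 0) / \<sigma>))"
    using measurable_B[OF s] by (intro integral_distr[symmetric]) auto
  also have "\<dots> = char std_normal_distribution (\<xi> * \<sigma>)"
    unfolding char_def distributed_distr_eq_density[OF D] ..
  also have "\<dots> = complex_of_real (exp (- (s * \<xi>\<^sup>2)))"
    unfolding char_std_normal_distribution using s by (simp add: \<sigma>_def power_mult_distrib mult.commute)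
  finally show ?thesis .
qed

lemma expectation_abs_B_continuous:
  fixes \<phi> :: "real \<Rightarrow> real"
  assumes "continuous_on UNIV (\<lambda>x. \<phi> \<bar>x\<bar>)" "\<And>x. \<bar>\<phi> x\<bar> \<le> 1"
  shows "continuous_on {0..} (\<lambda>t. expectation (\<lambda>\<omega>. \<phi> \<bar>B t \<omega>\<bar>))"
  using assms measurable_B B_continuous by (intro continuous_on_expectation[where K=1]) auto

text \<open>Exchanging the integrals over time and space leaves the Green function of the heat
  kernel; it is even, so folding onto the positive half-line doubles the factor 1/(2\<nu>).\<close>

lemma abs_B_laplace:
  fixes \<phi> :: "real \<Rightarrow> real"
  assumes \<nu>: "0 < \<nu>" and \<phi>: "continuous_on UNIV (\<lambda>x. \<phi> \<bar>x\<bar>)" "\<And>x. \<bar>\<phi> x\<bar> \<le> 1"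
  shows "(LBINT t:{0<..}. exp (- (\<nu>\<^sup>2 * t)) * expectation (\<lambda>\<omega>. \<phi> \<bar>B t \<omega>\<bar>))
    = (LBINT x:{0<..}. exp (- (\<nu> * x)) * \<phi> x) / \<nu>"
proof -
  have \<phi>_meas [measurable (raw)]: "(\<lambda>x. \<phi> \<bar>h x\<bar>) \<in> borel_measurable A"
    if "h \<in> borel_measurable A" for h :: "'c \<Rightarrow> real" and A
    by (rule measurable_compose[OF that borel_measurable_continuous_onI[OF \<phi>(1)]])
  define f where "f t x = indicat_real {0<..} t * exp (- (\<nu>\<^sup>2 * t)) * normal_density 0 (sqrt (2 * t)) x" for t x
  have f_meas [measurable]: "(\<lambda>p. f (fst p) (snd p)) \<in> borel_measurable (lborel \<Otimes>\<^sub>M lborel)"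
    unfolding f_def normal_density_def by measurable
  have f_nonneg: "0 \<le> f t x" for t x unfolding f_def by simp
  \<comment> \<open>For each positive time the kernel has mass 1 in space, so only the exponential
    in time remains.\<close>
  have "integrable (lborel \<Otimes>\<^sub>M lborel) (\<lambda>p. f (fst p) (snd p))"
  proof (rule lborel_pair.Fubini_integrable)
    show "(\<lambda>p. f (fst p) (snd p)) \<in> borel_measurable (lborel \<Otimes>\<^sub>M lborel)" by (rule f_meas)
    have "(LBINT x. norm (f t x)) = indicator {0<..} t *\<^sub>R exp (- (t * \<nu>\<^sup>2))" for t
      by (simp add: f_nonneg) (auto simp: f_def mult.commute split: split_indicator)
    then show "integrable lborel (\<lambda>t. LBINT x. norm (f (fst (t, x)) (snd (t, x))))"
      using integrable_I0i_exp_mscale[of "\<nu>\<^sup>2"] \<nu> by (simp add: set_integrable_def)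
    have "integrable lborel (f t)" for t
      by (cases "0 < t") (simp_all add: f_def[abs_def])
    then show "AE t in lborel. integrable lborel (\<lambda>x. f (fst (t, x)) (snd (t, x)))" by simp
  qed
  then have "integrable (lborel \<Otimes>\<^sub>M lborel) (case_prod (\<lambda>t x. f t x * \<phi> \<bar>x\<bar>))"
    by (rule Bochner_Integration.integrable_bound)
      (use \<phi>(2) in \<open>auto simp: case_prod_beta' abs_mult f_nonneg mult_left_le\<close>)
  note Fubini = lborel_pair.Fubini_integral[OF this]
  let ?g = "\<lambda>x. indicator {0<..} x *\<^sub>R (exp (- (\<nu> * x)) * \<phi> \<bar>x\<bar>)"
  \<comment> \<open>Folding an even function uses the closed half-line, the target the open one;
    they differ by the null set {0}, which \<open>heat_kernel_laplace\<close> excludes too.\<close>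
  let ?h = "\<lambda>x. indicator {0..} x *\<^sub>R (exp (- (\<nu> * \<bar>x\<bar>)) / (2 * \<nu>) * \<phi> \<bar>x\<bar>)"
  have AE_eq: "AE x in lborel. ?g x / (2 * \<nu>) = ?h x"
    using AE_lborel_singleton[of 0] by eventually_elim (auto split: split_indicator)
  have "set_integrable lborel {0<..} (\<lambda>x. exp (- (\<nu> * x)) * \<phi> \<bar>x\<bar>)"
    using \<phi> by (intro exp_times_bounded_set_integrable \<nu>) (auto intro: continuous_on_subset)
  then have "integrable lborel (\<lambda>x. ?g x / (2 * \<nu>))"
    unfolding set_integrable_def by (rule integrable_divide_zero)
  then have "integrable lborel ?h"
    by (rule integrable_cong_AE_imp[OF _ _ AE_eq]) measurable
  then have even: "has_bochner_integral lborel (\<lambda>x. exp (- (\<nu> * \<bar>x\<bar>)) / (2 * \<nu>) * \<phi> \<bar>x\<bar>) (2 *\<^sub>R (LBINT x. ?h x))"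
    by (intro has_bochner_integral_even_function has_bochner_integral_integrable) auto
  have "(LBINT t:{0<..}. exp (- (\<nu>\<^sup>2 * t)) * expectation (\<lambda>\<omega>. \<phi> \<bar>B t \<omega>\<bar>)) = (LBINT t. LBINT x. f t x * \<phi> \<bar>x\<bar>)"
    unfolding set_lebesgue_integral_def
  proof (rule Bochner_Integration.integral_cong[OF refl])
    fix t :: real
    show "indicat_real {0<..} t *\<^sub>R (exp (- (\<nu>\<^sup>2 * t)) * expectation (\<lambda>\<omega>. \<phi> \<bar>B t \<omega>\<bar>)) = (LBINT x. f t x * \<phi> \<bar>x\<bar>)"
    proof (cases "0 < t")
      case True
      have "expectation (\<lambda>\<omega>. \<phi> \<bar>B t \<omega>\<bar>) = (LBINT x. normal_density 0 (sqrt (2 * t)) x * \<phi> \<bar>x\<bar>)"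
        by (rule distributed_integral[OF B_distributed[OF True], symmetric]) auto
      then show ?thesis using True by (simp add: f_def mult.assoc)
    qed (simp add: f_def)
  qed
  also have "\<dots> = (LBINT x. LBINT t. f t x * \<phi> \<bar>x\<bar>)"
    by (rule Fubini[symmetric])
  also have "\<dots> = (LBINT x. exp (- (\<nu> * \<bar>x\<bar>)) / (2 * \<nu>) * \<phi> \<bar>x\<bar>)"
  proof (rule integral_cong_AE)
    show "(\<lambda>x. LBINT t. f t x * \<phi> \<bar>x\<bar>) \<in> borel_measurable lborel"
      unfolding f_def normal_density_def by measurable
    show "AE x in lborel. (LBINT t. f t x * \<phi> \<bar>x\<bar>) = exp (- (\<nu> * \<bar>x\<bar>)) / (2 * \<nu>) * \<phi> \<bar>x\<bar>"
      using AE_lborel_singleton[of 0]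
    proof eventually_elim
      case (elim x)
      have "normal_density 0 \<sigma> x = normal_density 0 \<sigma> \<bar>x\<bar>" for \<sigma> by (simp add: normal_density_def)
      then have "(LBINT t. f t x) = (LBINT t:{0<..}. exp (- (\<nu>\<^sup>2 * t)) * normal_density 0 (sqrt (2 * t)) \<bar>x\<bar>)"
        by (simp add: f_def set_lebesgue_integral_def mult.assoc)
      also have "\<dots> = exp (- (\<nu> * \<bar>x\<bar>)) / (2 * \<nu>)"
        using elim by (intro heat_kernel_laplace \<nu>) simp
      finally show ?case by simp
    qed
  qed measurable
  also have "\<dots> = 2 *\<^sub>R (LBINT x. ?h x)"
    using even by (rule has_bochner_integral_integral_eq)
  also have "(LBINT x. ?h x) = (LBINT x. ?g x / (2 * \<nu>))"
    by (rule integral_cong_AE[OF _ _ AE_eq, symmetric]) measurable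
  also have "\<dots> = (LBINT x. indicator {0<..} x *\<^sub>R (exp (- (\<nu> * x)) * \<phi> x)) / (2 * \<nu>)"
    unfolding integral_divide_zero
    by (intro arg_cong2[where f="(/)"] Bochner_Integration.integral_cong refl) (auto split: split_indicator)
  finally show ?thesis by (simp add: set_lebesgue_integral_def)
qed

end

subsection \<open>Equality of the laws\<close>

text \<open>Although the claim concerns one \<open>t\<close>, both sides are studied as functions of
  all positive times, as it is their transforms in time that are explicit. The two sides may live on
  different probability spaces; only laws are compared.\<close>

theorem theorem4p2:
  fixes c lam t :: real
    and M :: "'a measure" and B H L :: "real \<Rightarrow> 'a \<Rightarrow> real"
    and M' :: "'b measure" and B' T :: "real \<Rightarrow> 'b \<Rightarrow> real"
    and N :: "real \<Rightarrow> 'b \<Rightarrow> nat" and V :: "'b \<Rightarrow> real"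
  assumes "c > 0" and "lam > 0"
    and "brownian_motion M B" and "half_stable_subordinator M H"
    and "L = inverse_process (drifted_subordinator lam H)"
    and "prob_space.indep_processes M B L"
    and "brownian_motion M' B'" and "telegraph_data M' lam N c V"
    and "T = telegraph V N"
    and "prob_space.indep_processes M' T (\<lambda>s \<omega>. \<bar>B' s \<omega>\<bar>)"
    and "t > 0"
  shows "distr M borel (\<lambda>\<omega>. B (c\<^sup>2 * L t \<omega>) \<omega>) = distr M' borel (\<lambda>\<omega>. T \<bar>B' t \<omega>\<bar> \<omega>)"
proof (rule Levy_uniqueness)
  interpret B: brownian_motion M B by fact
  interpret H: half_stable_subordinator M H by fact
  interpret B': brownian_motion M' B' by fact
  interpret T: telegraph_data M' lam N c V by fact
  note L = \<open>L = inverse_process (drifted_subordinator lam H)\<close>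
  note T_eq = \<open>T = telegraph V N\<close>
  have L_nonneg: "0 \<le> L t \<omega>" if "\<omega> \<in> space M" for \<omega> t
    unfolding L by (rule H.inverse_process_nonneg[OF \<open>lam > 0\<close> that])
  have B_indep: "B.indep_var borel (B s) borel (\<lambda>\<omega>. c\<^sup>2 * L t \<omega>)" if "0 \<le> s" for s
    using B.indep_var_compose[OF B.indep_processesD[OF \<open>B.indep_processes B L\<close> that less_imp_le[OF \<open>t > 0\<close>]],
        of "\<lambda>x. x" borel "\<lambda>l. c\<^sup>2 * l" borel] by (simp add: comp_def)
  have T_indep: "B'.indep_var borel (T s) borel (\<lambda>\<omega>. \<bar>B' t \<omega>\<bar>)" if "0 \<le> s" for s
    using B'.indep_processesD[OF \<open>B'.indep_processes T _\<close> that less_imp_le[OF \<open>t > 0\<close>]] .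
  have rc: "continuous (at_right s) u" if "continuous_on {0..} u" "0 \<le> s" for s and u :: "real \<Rightarrow> real"
    using that by (auto simp: continuous_on_eq_continuous_within intro: continuous_within_subset)
  have W1 [measurable]: "(\<lambda>\<omega>. B (c\<^sup>2 * L t \<omega>) \<omega>) \<in> borel_measurable M"
  proof (rule right_continuous_process_measurable[where X=B and g="\<lambda>\<omega>. \<omega>" and M=M])
    show "continuous (at_right s) (\<lambda>s. B s \<omega>)" if "\<omega> \<in> space M" "0 \<le> s" for s \<omega>
      by (rule rc[OF B.B_continuous[OF that(1)] that(2)])
    show "(\<lambda>\<omega>. c\<^sup>2 * L t \<omega>) \<in> borel_measurable M"
      by (rule B.indep_var_rv2[OF B_indep[OF order_refl]])
  qed (simp_all add: B.measurable_B L_nonneg)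
  have W2 [measurable]: "(\<lambda>\<omega>. T \<bar>B' t \<omega>\<bar> \<omega>) \<in> borel_measurable M'"
    unfolding T_eq
  proof (rule right_continuous_process_measurable[where X="telegraph V N" and g="\<lambda>\<omega>. \<omega>" and M=M'])
    show "continuous (at_right s) (\<lambda>s. telegraph V N s \<omega>)" if "\<omega> \<in> space M'" "0 \<le> s" for s \<omega>
      by (rule rc[OF T.telegraph_continuous[OF that(1)] that(2)])
    show "(\<lambda>\<omega>. \<bar>B' t \<omega>\<bar>) \<in> borel_measurable M'"
      by (rule B'.indep_var_rv2[OF T_indep[OF order_refl]])
  qed (simp_all add: T.telegraph_measurable)
  show "real_distribution (distr M borel (\<lambda>\<omega>. B (c\<^sup>2 * L t \<omega>) \<omega>))"
    by (rule B.real_distribution_distr) (rule W1)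
  show "real_distribution (distr M' borel (\<lambda>\<omega>. T \<bar>B' t \<omega>\<bar> \<omega>))"
    by (rule B'.real_distribution_distr) (rule W2)
  show "char (distr M borel (\<lambda>\<omega>. B (c\<^sup>2 * L t \<omega>) \<omega>)) = char (distr M' borel (\<lambda>\<omega>. T \<bar>B' t \<omega>\<bar> \<omega>))"
  proof
    fix \<xi> :: real
    define \<theta> where "\<theta> = (\<xi> * c)\<^sup>2"
    have \<theta>: "0 \<le> \<theta>" by (simp add: \<theta>_def)
    have iexp_cont: "continuous_on UNIV (\<lambda>x. iexp (\<xi> * x))" by (intro continuous_intros)
    have iexp_bdd: "norm (iexp (\<xi> * x)) \<le> 1" for x by simp
    have "char (distr M borel (\<lambda>\<omega>. B (c\<^sup>2 * L t \<omega>) \<omega>)) \<xi> = B.expectation (\<lambda>\<omega>. iexp (\<xi> * B (c\<^sup>2 * L t \<omega>) \<omega>))"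
      unfolding char_def by (subst integral_distr) auto
    also have "\<dots> = B.expectation (\<lambda>\<omega>. B.expectation (\<lambda>\<omega>'. iexp (\<xi> * B (c\<^sup>2 * L t \<omega>) \<omega>')))"
      using L_nonneg B.B_continuous
      by (intro B.expectation_at_independent_time[where \<psi>="\<lambda>x. iexp (\<xi> * x)", OF B_indep _ _ iexp_cont iexp_bdd]) auto
    also have "\<dots> = B.expectation (\<lambda>\<omega>. complex_of_real (exp (- (\<theta> * L t \<omega>))))"
    proof (rule Bochner_Integration.integral_cong[OF refl])
      fix \<omega> assume "\<omega> \<in> space M"
      then have "B.expectation (\<lambda>\<omega>'. iexp (\<xi> * B (c\<^sup>2 * L t \<omega>) \<omega>'))
          = complex_of_real (exp (- (c\<^sup>2 * L t \<omega> * \<xi>\<^sup>2)))"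
        using L_nonneg by (intro B.B_char) simp
      also have "c\<^sup>2 * L t \<omega> * \<xi>\<^sup>2 = \<theta> * L t \<omega>"
        by (simp add: \<theta>_def power_mult_distrib)
      finally show "B.expectation (\<lambda>\<omega>'. iexp (\<xi> * B (c\<^sup>2 * L t \<omega>) \<omega>')) = complex_of_real (exp (- (\<theta> * L t \<omega>)))" .
    qed
    also have "\<dots> = complex_of_real (B.expectation (\<lambda>\<omega>. exp (- (\<theta> * L t \<omega>))))"
      by (rule integral_complex_of_real)
    also have "B.expectation (\<lambda>\<omega>. exp (- (\<theta> * L t \<omega>))) = B'.expectation (\<lambda>\<omega>. T.cos_mean (\<xi> * c) \<bar>B' t \<omega>\<bar>)"
    proof -
      define \<phi> where "\<phi> = T.cos_mean (\<xi> * c)"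
      have \<phi>: "continuous_on UNIV (\<lambda>x. \<phi> \<bar>x\<bar>)" "\<And>x. \<bar>\<phi> x\<bar> \<le> 1"
        unfolding \<phi>_def
        by (rule continuous_on_compose2[OF T.cos_mean_continuous]) (auto intro!: continuous_intros T.abs_cos_mean_le)
      \<comment> \<open>Both functions are cut off at nonpositive times, since the hypotheses do not
        constrain \<open>B'\<close> at negative times.\<close>
      define f where "f t = (if 0 < t then B.expectation (\<lambda>\<omega>. exp (- (\<theta> * L t \<omega>))) else 0)" for t
      define g where "g t = (if 0 < t then B'.expectation (\<lambda>\<omega>. \<phi> \<bar>B' t \<omega>\<bar>) else 0)" for t
      have "f t = g t"
      proof (rule laplace_transform_unique[OF _ _ _ _ _ \<open>t > 0\<close>])
        show "continuous_on {0<..} f"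
          by (rule continuous_on_eq[OF H.inverse_process_expectation_continuous[OF \<open>lam > 0\<close> \<theta>]]) (simp add: f_def L)
        show "continuous_on {0<..} g"
          by (rule continuous_on_eq[OF continuous_on_subset[OF B'.expectation_abs_B_continuous[OF \<phi>]]])
            (auto simp: g_def)
        show "\<bar>f t\<bar> \<le> 1" for t
        proof -
          have "\<bar>B.expectation (\<lambda>\<omega>. exp (- (\<theta> * L t \<omega>)))\<bar> \<le> B.expectation (\<lambda>\<omega>. 1)"
            using L_nonneg \<theta>
            by (intro order_trans[OF integral_abs_bound] integral_mono') auto
          then show ?thesis by (simp add: f_def B.prob_space)
        qed
        show "\<bar>g t\<bar> \<le> 1" for t
        proof -
          have "\<bar>B'.expectation (\<lambda>\<omega>. \<phi> \<bar>B' t \<omega>\<bar>)\<bar> \<le> B'.expectation (\<lambda>\<omega>. 1)"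
            using \<phi>(2) by (intro order_trans[OF integral_abs_bound] integral_mono') auto
          then show ?thesis by (simp add: g_def B'.prob_space)
        qed
        fix \<nu> :: real assume \<nu>: "0 < \<nu>"
        have "(LBINT t:{0<..}. exp (- (\<nu>\<^sup>2 * t)) * f t)
            = (LBINT t:{0<..}. exp (- (\<nu>\<^sup>2 * t)) * B.expectation (\<lambda>\<omega>. exp (- (\<theta> * L t \<omega>))))"
          by (rule set_lebesgue_integral_cong) (auto simp: f_def)
        also have "\<dots> = (\<nu> + 2 * lam) / (\<nu> * (\<nu> * (\<nu> + 2 * lam) + \<theta>))"
          unfolding L by (rule H.inverse_process_laplace[OF \<open>lam > 0\<close> \<theta> \<nu>])
        \<comment> \<open>Here the two sides meet: \<open>\<theta>\<close> is the square of
          \<open>k = \<xi> * c\<close>, the Poisson rate is \<open>lam\<close>, and the extra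
          1/\<nu> comes from \<open>abs_B_laplace\<close>.\<close>
        also have "\<dots> = (LBINT x:{0<..}. exp (- (\<nu> * x)) * \<phi> x) / \<nu>"
          unfolding \<phi>_def T.cos_mean_laplace[OF \<nu>] \<theta>_def by (simp add: mult.commute)
        also have "\<dots> = (LBINT t:{0<..}. exp (- (\<nu>\<^sup>2 * t)) * B'.expectation (\<lambda>\<omega>. \<phi> \<bar>B' t \<omega>\<bar>))"
          by (rule B'.abs_B_laplace[OF \<nu> \<phi>, symmetric])
        also have "\<dots> = (LBINT t:{0<..}. exp (- (\<nu>\<^sup>2 * t)) * g t)"
          by (rule set_lebesgue_integral_cong) (auto simp: g_def)
        finally show "(LBINT t:{0<..}. exp (- (\<nu>\<^sup>2 * t)) * f t) = (LBINT t:{0<..}. exp (- (\<nu>\<^sup>2 * t)) * g t)" .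
      qed
      then show ?thesis using \<open>t > 0\<close> by (simp add: f_def g_def \<phi>_def)
    qed
    also have "complex_of_real \<dots> = B'.expectation (\<lambda>\<omega>. complex_of_real (T.cos_mean (\<xi> * c) \<bar>B' t \<omega>\<bar>))"
      by (rule integral_complex_of_real[symmetric])
    also have "\<dots> = B'.expectation (\<lambda>\<omega>. B'.expectation (\<lambda>\<omega>'. iexp (\<xi> * T \<bar>B' t \<omega>\<bar> \<omega>')))"
      unfolding T_eq by (simp only: T.telegraph_char[OF abs_ge_zero])
    also have "\<dots> = B'.expectation (\<lambda>\<omega>. iexp (\<xi> * T \<bar>B' t \<omega>\<bar> \<omega>))"
      using T.telegraph_continuous unfolding T_eq[symmetric]
      by (intro B'.expectation_at_independent_time[where \<psi>="\<lambda>x. iexp (\<xi> * x)", OF T_indep _ _ iexp_cont iexp_bdd, symmetric]) auto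
    also have "\<dots> = char (distr M' borel (\<lambda>\<omega>. T \<bar>B' t \<omega>\<bar> \<omega>)) \<xi>"
      unfolding char_def by (subst integral_distr) auto
    finally show "char (distr M borel (\<lambda>\<omega>. B (c\<^sup>2 * L t \<omega>) \<omega>)) \<xi> = char (distr M' borel (\<lambda>\<omega>. T \<bar>B' t \<omega>\<bar> \<omega>)) \<xi>" .
  qed
qed

end
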